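(* Let $L$ be an atomic lattice with set of atoms $E$ and let $\mathcal G$ be a building set in $L$. Then $$p(\Delta_0^{-1}(\Sigma^{2\mathcal G}))=\Sigma_{\mathcal G}\qquad\text{and}\qquad \overline p(\Delta_0^{-1}(\mathcal U_{\mathcal G}))=\overline\Sigma_{\mathcal G}:=\Sigma_{\mathcal G}/\langle u_{\mathrm{tot}}\rangle.$$ In particular, refinements of $\Sigma^{2\mathcal G}$ induce refinements of $\Sigma_{\mathcal G}$, and refinements of $\mathcal U_{\mathcal G}$ induce refinements of $\overline\Sigma_{\mathcal G}$.
   Context: All lattices are finite. Let $L$ be a lattice with minimum $\hat 0$ and maximum $\hat 1$. $L$ is atomic if every element is the join of the atoms below it; $f\in L$ is identified with the set of atoms $e\le f$. A building set is a subset $\mathcal G\subseteq L_{>\hat 0}$ with $\hat 1\in\mathcal G$ such that for every $f\in L_{>\hat 0}\setminus\mathcal G$, the interval $[\hat 0,f]$ is the product lattice $[\hat 0,g_1]\times\dots\times[\hat 0,g_k]$, where $g_1,\dots,g_k$ are the maximal elements of $\mathcal G$ below $f$. A subset $N\subseteq\mathcal G$ is nested if for all $k\ge2$ and pairwise incomparable $f_1,\dots,f_k\in N$, $f_1\vee\dots\vee f_k\notin\mathcal G$; $\mathcal N(L,\mathcal G)$ is the complex of nested sets. $\mathbb R^{\mathcal G}$ is the vector space with basis $\mathcal G$. $\mathbb R^{2\mathcal G}$ has basis $f^+,f^-$ ($f\in\mathcal G$), with dual coordinates $p_f,m_f$. For nested $N$, $\mathbb R_+^{N}$ and $\mathbb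 R_+^{2N}$ are the cones spanned by the $f$, resp. the $f^+,f^-$, with $f\in N$. The doubled free nested set fan $\Sigma^{2\mathcal G}$ is the fan in $\mathbb R^{2\mathcal G}$ consisting of the cones $\mathbb R_+^{2N}$, $N\in\mathcal N(L,\mathcal G)$, and their faces. The causal cone is the cone in $\mathbb R^{2\mathcal G}$ cut out by $m_{\hat 1}=0$ and $p_g,m_g,F_g\ge0$ for all $g\in\mathcal G$, where $F_g:=p_{\hat 1}+\sum_{f\in\mathcal G,\,g<f<\hat 1}(p_f-m_f)-m_g$. The universe fan $\mathcal U_{\mathcal G}$ is the fan obtained by intersecting the cones of $\Sigma^{2\mathcal G}$ with the causal cone. Maps: $\Delta_0:\mathbb R^{\mathcal G}\to\mathbb R^{2\mathcal G}$ is the linear embedding with $\hat 1\mapsto\hat 1^+$ and $g\mapsto g^++g^-$ for $g\ne\hat 1$; $p:\mathbb R^{\mathcal G}\to\mathbb R^E$ is the linear map $f\mapsto\sum_{e\in f}e$; $\overline p:\mathbb R^{\mathcal G}\to\mathbb R^E/\langle u_{\mathrm{tot}}\rangle$ is $p$ followed by the quotient map, where $u_{\mathrm{tot}}=\sum_{e\in E}e=p(\hat 1)$. For a fan $\Gamma$ in $\mathbb R^{2\mathcal G}$, $\Delta_0^{-1}(\Gamma)$ denotes its preimage under $\Delta_0$, and $p(\Delta_0^{-1}(\Gamma))$, $\overline p(\Delta_0^{-1}(\Gamma))$ the images of that preimage; the refinement induced by a refinement $\Gamma$ of $\Sigma^{2\mathcal G}$, resp. of $\mathcal U_{\mathcal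 G}$, is $p(\Delta_0^{-1}(\Gamma))$, resp. $\overline p(\Delta_0^{-1}(\Gamma))$. The nested set fan $\Sigma_{\mathcal G}$ in $\mathbb R^E$ has cones $p(\mathbb R_+^N)$, $N\in\mathcal N(L,\mathcal G)$. $\Sigma_{\mathcal G}/\langle u_{\mathrm{tot}}\rangle$ is the link of the ray spanned by $u_{\mathrm{tot}}$: the fan of images in $\mathbb R^E/\langle u_{\mathrm{tot}}\rangle$ of the cones containing $u_{\mathrm{tot}}$.
   Formalization: Images under p̄ of all cones of a refinement of U_G (even of U_G with its faces) need not form a fan; for the face-closed U_G and its refinements, only images of cones containing the ray of 1̂ are taken. The literal equality is proved for the bare intersections with the causal cone. *)

theory Defs
  imports "HOL-Analysis.Analysis"
begin

text \<open>
  A finite lattice L is a type of sort \<open>{finite, complete_lattice}\<close>; every nonempty finite lattice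
  is complete in exactly one way.
\<close>

section \<open>Building sets and nested sets\<close>

definition atoms :: "'a::{finite,complete_lattice} set" where
  "atoms = {a. bot < a \<and> (\<forall>b. b < a \<longrightarrow> b = bot)}"

text \<open>
  That [0,f] ``is the product'' of the intervals [0,g], \<open>g \<in> M\<close>, means that the join map
  \<open>h \<mapsto> SUP g\<in>M. h g\<close> is an isomorphism of posets from the product onto [0,f].  For empty
  \<open>M\<close> the product has one element.
\<close>

definition interval_is_product :: "'a::{finite,complete_lattice} \<Rightarrow> 'a set \<Rightarrow> bool" where
  "interval_is_product f M \<longleftrightarrow>
     bij_betw (\<lambda>h. SUP g\<in>M. h g) (\<Pi>\<^sub>E g\<in>M. {bot..g}) {bot..f} \<and>
     (\<forall>h \<in> \<Pi>\<^sub>E g\<in>M. {bot..g}. \<forall>h' \<in> \<Pi>\<^sub>E g\<in>M. {bot..g}.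
        (\<forall>g\<in>M. h g \<le> h' g) \<longleftrightarrow> (SUP g\<in>M. h g) \<le> (SUP g\<in>M. h' g))"

definition max_below :: "'a::{finite,complete_lattice} set \<Rightarrow> 'a \<Rightarrow> 'a set" where
  "max_below G f = {g \<in> G. g \<le> f \<and> (\<forall>h\<in>G. h \<le> f \<longrightarrow> \<not> g < h)}"

definition building_set :: "'a::{finite,complete_lattice} set \<Rightarrow> bool" where
  "building_set G \<longleftrightarrow>
     bot \<notin> G \<and> top \<in> G \<and>
     (\<forall>f. f \<noteq> bot \<longrightarrow> f \<notin> G \<longrightarrow> interval_is_product f (max_below G f))"

definition nested :: "'a::{finite,complete_lattice} set \<Rightarrow> 'a set \<Rightarrow> bool" where
  "nested G N \<longleftrightarrow>
     N \<subseteq> G \<and>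
     (\<forall>A \<subseteq> N. card A \<ge> 2 \<longrightarrow> pairwise (\<lambda>f g. \<not> f \<le> g \<and> \<not> g \<le> f) A \<longrightarrow> Sup A \<notin> G)"


section \<open>Fans and refinements\<close>

definition fan :: "'b::real_vector set set \<Rightarrow> bool" where
  "fan \<Gamma> \<longleftrightarrow>
     finite \<Gamma> \<and>
     (\<forall>\<sigma>\<in>\<Gamma>. \<exists>S. finite S \<and> \<sigma> = convex_cone hull S) \<and>
     (\<forall>\<sigma>\<in>\<Gamma>. \<forall>\<tau>. \<tau> face_of \<sigma> \<longrightarrow> \<tau> \<noteq> {} \<longrightarrow> \<tau> \<in> \<Gamma>) \<and>
     (\<forall>\<sigma>\<in>\<Gamma>. \<forall>\<tau>\<in>\<Gamma>. (\<sigma> \<inter> \<tau>) face_of \<sigma>)"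

definition subdivides :: "'b set set \<Rightarrow> 'b set set \<Rightarrow> bool" where
  "subdivides \<Gamma> \<Sigma> \<longleftrightarrow> \<Union>\<Gamma> = \<Union>\<Sigma> \<and> (\<forall>\<gamma>\<in>\<Gamma>. \<exists>\<sigma>\<in>\<Sigma>. \<gamma> \<subseteq> \<sigma>)"

definition fan_refines :: "'b::real_vector set set \<Rightarrow> 'b set set \<Rightarrow> bool" where
  "fan_refines \<Gamma> \<Sigma> \<longleftrightarrow> fan \<Gamma> \<and> subdivides \<Gamma> \<Sigma>"

definition image_cones :: "('b \<Rightarrow> 'c) \<Rightarrow> 'b set set \<Rightarrow> 'c set set" where
  "image_cones \<phi> \<Gamma> = {\<phi> ` \<sigma> | \<sigma>. \<sigma> \<in> \<Gamma>}"


section \<open>The doubled free nested set fan and the universe fan\<close>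

text \<open>
  The spaces spanned by \<open>G\<close> and by the atoms are the coordinate subspaces of \<open>real ^ 'a\<close> of
  vectors supported on \<open>G\<close> resp. on the atoms.  The doubled space consists of pairs \<open>(x, y)\<close>
  with both components supported on \<open>G\<close>; the coordinates are \<open>p\<^sub>f = x $ f\<close> and \<open>m\<^sub>f = y $ f\<close>.
\<close>

type_synonym 'a rvec = "(real, 'a) vec"
type_synonym 'a dvec = "'a rvec \<times> 'a rvec"

definition space_on :: "'a::finite set \<Rightarrow> 'a rvec set" where
  "space_on G = {x. \<forall>f. f \<notin> G \<longrightarrow> x $ f = 0}"

definition basis_vec :: "'a::finite \<Rightarrow> 'a rvec" where
  "basis_vec f = axis f 1"

definition plus_vec :: "'a::finite \<Rightarrow> 'a dvec" where
  "plus_vec f = (axis f 1, 0)"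

definition minus_vec :: "'a::finite \<Rightarrow> 'a dvec" where
  "minus_vec f = (0, axis f 1)"

definition nested_cone :: "'a::finite set \<Rightarrow> 'a rvec set" where
  "nested_cone N = convex_cone hull (basis_vec ` N)"

definition doubled_cone :: "'a::finite set \<Rightarrow> 'a dvec set" where
  "doubled_cone N = convex_cone hull (plus_vec ` N \<union> minus_vec ` N)"

definition doubled_fan ::
    "'a::{finite,complete_lattice} set \<Rightarrow> 'a dvec set set" where
  "doubled_fan G = {\<tau>. \<exists>N. nested G N \<and> \<tau> face_of doubled_cone N \<and> \<tau> \<noteq> {}}"

definition F_coord ::
    "'a::{finite,complete_lattice} set \<Rightarrow> 'a \<Rightarrow> 'a dvec \<Rightarrow> real" where
  "F_coord G g v =
     fst v $ top + (\<Sum>f\<in>{f\<in>G. g < f \<and> f < top}. fst v $ f - snd v $ f) - snd v $ g"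

definition causal_cone ::
    "'a::{finite,complete_lattice} set \<Rightarrow> 'a dvec set" where
  "causal_cone G =
     {v \<in> space_on G \<times> space_on G.
        snd v $ top = 0 \<and>
        (\<forall>g\<in>G. 0 \<le> fst v $ g \<and> 0 \<le> snd v $ g \<and> 0 \<le> F_coord G g v)}"

text \<open>
  The intersections of the cones of the doubled fan with the causal cone are not closed under
  taking faces (a face may lie on a hyperplane \<open>F\<^sub>g = 0\<close>), so the fan they generate also contains
  all their faces.
\<close>

definition causal_sections ::
    "'a::{finite,complete_lattice} set \<Rightarrow> 'a dvec set set" where
  "causal_sections G = {\<sigma> \<inter> causal_cone G | \<sigma>. \<sigma> \<in> doubled_fan G}"

definition universe_fan ::
    "'a::{finite,complete_lattice} set \<Rightarrow> 'a dvec set set" where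
  "universe_fan G = {\<tau>. \<exists>\<sigma>\<in>causal_sections G. \<tau> face_of \<sigma> \<and> \<tau> \<noteq> {}}"


section \<open>The linear maps\<close>

definition Delta0 ::
    "'a::{finite,complete_lattice} set \<Rightarrow> 'a rvec \<Rightarrow> 'a dvec" where
  "Delta0 G x =
     (\<Sum>g\<in>G. x $ g *\<^sub>R (if g = top then plus_vec g else plus_vec g + minus_vec g))"

definition Delta0_preimage ::
    "'a::{finite,complete_lattice} set \<Rightarrow> 'a dvec set set \<Rightarrow> 'a rvec set set" where
  "Delta0_preimage G \<Gamma> = {{x \<in> space_on G. Delta0 G x \<in> \<sigma>} | \<sigma>. \<sigma> \<in> \<Gamma>}"

definition p_map :: "'a::{finite,complete_lattice} set \<Rightarrow> 'a rvec \<Rightarrow> 'a rvec" where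
  "p_map G x = (\<Sum>f\<in>G. x $ f *\<^sub>R (\<Sum>e\<in>{e\<in>atoms. e \<le> f}. basis_vec e))"

definition u_tot :: "'a::{finite,complete_lattice} rvec" where
  "u_tot = (\<Sum>e\<in>atoms. basis_vec e)"

text \<open>
  The quotient vector space by the line spanned by \<open>u_tot\<close>.  It is formed from the whole of
  \<open>real ^ 'a\<close>; the quotient of the span of the atoms is a subspace of it, and all cones below
  lie in that subspace.
\<close>

definition utot_rel :: "'a::{finite,complete_lattice} rvec \<Rightarrow> 'a rvec \<Rightarrow> bool" where
  "utot_rel v w \<longleftrightarrow> v - w \<in> span {u_tot}"

lemma equivp_utot_rel:
  "equivp (utot_rel :: 'a::{finite,complete_lattice} rvec \<Rightarrow> 'a rvec \<Rightarrow> bool)"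
proof (rule equivpI)
  show "reflp (utot_rel :: 'a rvec \<Rightarrow> 'a rvec \<Rightarrow> bool)"
    by (simp add: reflp_def utot_rel_def span_zero)
  show "symp (utot_rel :: 'a rvec \<Rightarrow> 'a rvec \<Rightarrow> bool)"
  proof (rule sympI)
    fix v w :: "'a rvec"
    assume "utot_rel v w"
    then show "utot_rel w v"
      using span_neg[of "v - w" "{u_tot}"] by (simp add: utot_rel_def)
  qed
  show "transp (utot_rel :: 'a rvec \<Rightarrow> 'a rvec \<Rightarrow> bool)"
  proof (rule transpI)
    fix u v w :: "'a rvec"
    assume "utot_rel u v" "utot_rel v w"
    then show "utot_rel u w"
      using span_add[of "u - v" "{u_tot}" "v - w"] by (simp add: utot_rel_def)
  qed
qed

quotient_type (overloaded) 'a mod_utot = "'a::{finite,complete_lattice} rvec" / utot_rel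
  by (rule equivp_utot_rel)

instantiation mod_utot :: ("{finite,complete_lattice}") real_vector
begin

lift_definition zero_mod_utot :: "'a mod_utot" is 0 .

lift_definition plus_mod_utot :: "'a mod_utot \<Rightarrow> 'a mod_utot \<Rightarrow> 'a mod_utot" is "(+)"
proof -
  fix u u' v v' :: "'a rvec"
  assume "utot_rel u u'" "utot_rel v v'"
  then show "utot_rel (u + v) (u' + v')"
    using span_add[of "u - u'" "{u_tot}" "v - v'"] by (simp add: utot_rel_def algebra_simps)
qed

lift_definition uminus_mod_utot :: "'a mod_utot \<Rightarrow> 'a mod_utot" is uminus
proof -
  fix v w :: "'a rvec"
  assume "utot_rel v w"
  then show "utot_rel (- v) (- w)"
    using span_neg[of "v - w" "{u_tot}"] by (simp add: utot_rel_def algebra_simps)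
qed

lift_definition minus_mod_utot :: "'a mod_utot \<Rightarrow> 'a mod_utot \<Rightarrow> 'a mod_utot" is "(-)"
proof -
  fix u u' v v' :: "'a rvec"
  assume "utot_rel u u'" "utot_rel v v'"
  then show "utot_rel (u - v) (u' - v')"
    using span_diff[of "u - u'" "{u_tot}" "v - v'"] by (simp add: utot_rel_def algebra_simps)
qed

lift_definition scaleR_mod_utot :: "real \<Rightarrow> 'a mod_utot \<Rightarrow> 'a mod_utot" is scaleR
proof -
  fix c :: real and v w :: "'a rvec"
  assume "utot_rel v w"
  then show "utot_rel (c *\<^sub>R v) (c *\<^sub>R w)"
    using span_mul[of "v - w" "{u_tot}" c] by (simp add: utot_rel_def algebra_simps)
qed

instance
  by standard (transfer, simp add: utot_rel_def span_zero algebra_simps)+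

end

lift_definition quot_map :: "'a::{finite,complete_lattice} rvec \<Rightarrow> 'a mod_utot" is "\<lambda>v. v" .

definition pbar_map :: "'a::{finite,complete_lattice} set \<Rightarrow> 'a rvec \<Rightarrow> 'a mod_utot" where
  "pbar_map G x = quot_map (p_map G x)"


section \<open>The nested set fan and its link\<close>

definition nested_fan :: "'a::{finite,complete_lattice} set \<Rightarrow> 'a rvec set set" where
  "nested_fan G = {p_map G ` nested_cone N | N. nested G N}"

definition quot_fan :: "'a::{finite,complete_lattice} rvec set set \<Rightarrow> 'a mod_utot set set" where
  "quot_fan \<Sigma> = {quot_map ` \<sigma> | \<sigma>. \<sigma> \<in> \<Sigma> \<and> u_tot \<in> \<sigma>}"

definition reduced_nested_fan ::
    "'a::{finite,complete_lattice} set \<Rightarrow> 'a mod_utot set set" where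
  "reduced_nested_fan G = quot_fan (nested_fan G)"

text \<open>
  The image of a fan \<open>\<Gamma>\<close> under \<open>pbar\<close>, as a fan: its image under \<open>p\<close>, followed by the quotient of
  fans by \<open>u_tot\<close>, that is, the link of the ray of \<open>u_tot\<close>.  Since \<open>pbar\<close> collapses a
  ray that lies in the support of \<open>\<Gamma>\<close>, the images under \<open>pbar\<close> of the remaining cones need not fit
  together to a fan.  For example, let the lattice be that of subsets of \<open>{a, b, c}\<close>, let \<open>G\<close>
  consist of the singletons and the top element, and let \<open>\<Gamma>\<close> be the preimage of the universe fan.
  Then the cone \<open>{x\<^sub>1 \<ge> x\<^sub>a, x\<^sub>1 \<ge> x\<^sub>b, x\<^sub>a \<ge> 0, x\<^sub>b \<ge> 0}\<close> of \<open>\<Gamma>\<close> has image \<open>{x\<^sub>a \<ge> 0, x\<^sub>b \<ge> 0}\<close>, while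
  its face where \<open>x\<^sub>1 = x\<^sub>a\<close> has image \<open>{x\<^sub>a \<ge> x\<^sub>b \<ge> 0}\<close>.
\<close>

definition pbar_fan ::
    "'a::{finite,complete_lattice} set \<Rightarrow> 'a rvec set set \<Rightarrow> 'a mod_utot set set" where
  "pbar_fan G \<Gamma> = quot_fan (image_cones (p_map G) \<Gamma>)"

end

theory Submission
  imports Defs
begin

text \<open>
  The inclusion of \<open>\<real>\<^sup>G\<close> in the doubled space identifies the section of the cone of \<open>f\<^sup>+\<close>, \<open>f\<^sup>-\<close> (\<open>f \<in> N\<close>)
  with the orthant \<open>nested_cone N\<close>, and the section of each of its faces with a coordinate face of this
  orthant (\<open>Delta0_preimage_doubled_fan\<close>).  So the preimage of the doubled fan consists of the orthants of
  the nested sets, whose images under \<open>p\<close> are by definition the cones of the nested set fan.  The causal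
  cone cuts each orthant by the inequalities \<open>x\<^sub>g \<le> x\<^bsub>top\<^esub>\<close>.  Modulo \<open>u_tot\<close>, the image of the
  basis vector of \<open>top\<close>, the coordinate \<open>x\<^bsub>top\<^esub>\<close> can be made as large as desired, and these inequalities
  disappear.  A face of such a section that contains the basis vector of \<open>top\<close> does not lie on any of the
  hyperplanes \<open>x\<^sub>g = x\<^bsub>top\<^esub>\<close>, so in the quotient it again becomes the cone of a nested set.

  That images of refinements are fans rests on the injectivity of \<open>p\<close> on the union of the orthants
  (\<open>p_map_inj_nested\<close>), the one place where building sets, nestedness and atomicity interact.
  A vector \<open>x\<close> of an orthant is determined by the sums of \<open>x\<^sub>f\<close> over all \<open>f \<ge> g\<close>, \<open>g \<in> G\<close>, by Moebius inversion, and
  such a sum is at least \<open>t > 0\<close> exactly if \<open>g\<close> lies below the join of the atoms at which \<open>p x\<close> is at least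
  \<open>t\<close>.  The proof of the latter uses that an element of \<open>G\<close> below a join of members of a nested set is
  below one of them (\<open>le_Sup_nested\<close>), which holds because an antichain in a nested set consists of the
  product factors of its join.

  The rest concerns fans in general.  Linear preimages of fans are fans (\<open>fan_linear_preimage\<close>), and so is the
  image of the star of a vector \<open>e\<close> under a linear map that identifies points of the support only
  along \<open>e\<close> (\<open>fan_image_star\<close>).  The latter is applied to \<open>p\<close> with \<open>e = 0\<close> and to \<open>pbar\<close> with \<open>e\<close> the basis
  vector of \<open>top\<close>.  In the second case, the star also covers the link: a half-line in
  direction \<open>e\<close> meets one of the finitely many cones infinitely often, and this closed cone contains \<open>e\<close> (\<open>fan_star_absorbs\<close>).
\<close>

section \<open>Faces, preimages and images of convex cones\<close>

lemma convex_cone_sum: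
  assumes "convex_cone C" "\<And>i. i \<in> I \<Longrightarrow> f i \<in> C"
  shows "sum f I \<in> C"
  using assms(2)
  by (induction I rule: infinite_finite_induct)
    (auto intro: convex_cone_add[OF assms(1)] simp: convex_cone_contains_0[OF assms(1)])

text \<open>
  In a cone, an open segment between \<open>a\<close> and \<open>b\<close> contains a point of \<open>F\<close> precisely when \<open>F\<close> contains
  a sum of positive multiples of \<open>a\<close> and \<open>b\<close>, and a cone \<open>F\<close> does not see the multiples.  So faces are
  the subcones that contain all summands of their elements, a description that linear maps
  carry back and forth without any case distinction on degenerate segments.
\<close>

lemma face_of_cone_iff:
  assumes D: "convex_cone D"
  shows "F face_of D \<and> F \<noteq> {} \<longleftrightarrow>
    convex_cone F \<and> F \<subseteq> D \<and> (\<forall>u\<in>D. \<forall>w\<in>D. u + w \<in> F \<longrightarrow> u \<in> F)"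
    (is "?L \<longleftrightarrow> ?R")
proof
  assume L: ?L
  then have F: "convex_cone F" "F \<subseteq> D"
    using D by (auto simp: convex_cone_def face_of_imp_subset intro: face_of_conic face_of_imp_convex)
  have "u \<in> F" if "u \<in> D" "w \<in> D" "u + w \<in> F" for u w
  proof (cases "u = w")
    case True
    have "(1/2) *\<^sub>R (u + w) \<in> F"
      using F(1) that(3) by (intro convex_cone_scaleR) auto
    then show ?thesis
      using True by (simp flip: scaleR_2)
  next
    case False
    have "u + w \<in> open_segment (2 *\<^sub>R u) (2 *\<^sub>R w)"
      unfolding in_segment using False by (auto intro!: exI[of _ "1/2"])
    moreover have "2 *\<^sub>R u \<in> D" "2 *\<^sub>R w \<in> D"
      using D that by (auto intro: convex_cone_scaleR)
    ultimately have "2 *\<^sub>R u \<in> F"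
      using L that(3) face_ofD by blast
    from convex_cone_scaleR[OF F(1) _ this, of "1/2"] show ?thesis
      by simp
  qed
  with F show ?R
    by blast
next
  assume R: ?R
  have "a \<in> F \<and> b \<in> F" if ab: "a \<in> D" "b \<in> D" and x: "x \<in> F" "x \<in> open_segment a b" for a b x
  proof -
    obtain t where t: "0 < t" "t < 1" "x = (1 - t) *\<^sub>R a + t *\<^sub>R b"
      using x(2) by (auto simp: in_segment)
    have "(1 - t) *\<^sub>R a \<in> D" "t *\<^sub>R b \<in> D"
      using t ab D by (auto intro: convex_cone_scaleR)
    then have *: "(1 - t) *\<^sub>R a \<in> F" "t *\<^sub>R b \<in> F"
      using R x(1) t(3) by (auto simp: add.commute)
    have "(1 / (1 - t)) *\<^sub>R ((1 - t) *\<^sub>R a) \<in> F" "(1 / t) *\<^sub>R (t *\<^sub>R b) \<in> F"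
      using R t * by (auto intro!: convex_cone_scaleR simp del: scaleR_scaleR)
    then show ?thesis
      using t by simp
  qed
  moreover have "F \<subseteq> D" "convex F" "F \<noteq> {}"
    using R by (auto simp: convex_cone_def)
  ultimately show ?L
    unfolding face_of_def by blast
qed

lemma face_of_convex_coneI:
  assumes "convex_cone D" "convex_cone F" "F \<subseteq> D"
    and "\<And>u w. u \<in> D \<Longrightarrow> w \<in> D \<Longrightarrow> u + w \<in> F \<Longrightarrow> u \<in> F"
  shows "F face_of D" "F \<noteq> {}"
  using face_of_cone_iff[OF assms(1), of F] assms by blast+

lemma face_of_convex_coneD:
  assumes "convex_cone D" "F face_of D" "F \<noteq> {}"
  shows "convex_cone F" "F \<subseteq> D"
    and "\<And>u w. u \<in> D \<Longrightarrow> w \<in> D \<Longrightarrow> u + w \<in> F \<Longrightarrow> u \<in> F"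
  using face_of_cone_iff[OF assms(1), of F] assms by blast+

lemma convex_cone_linear_preimage:
  assumes "convex_cone C" "convex_cone V" "linear f"
  shows "convex_cone {x \<in> V. f x \<in> C}"
  using assms by (auto simp: convex_cone_iff linear_0 linear_add linear_scale)

lemma face_of_linear_preimage:
  assumes D: "convex_cone D" and V: "convex_cone V" and f: "linear f"
    and F: "F face_of D" "F \<noteq> {}" and sub: "f ` V \<subseteq> D"
  shows "{x \<in> V. f x \<in> F} face_of V" "{x \<in> V. f x \<in> F} \<noteq> {}"
proof -
  note FD = face_of_convex_coneD[OF D F]
  have "u \<in> {x \<in> V. f x \<in> F}" if "u \<in> V" "w \<in> V" "u + w \<in> {x \<in> V. f x \<in> F}" for u w
    using FD(3)[of "f u" "f w"] that sub by (auto simp: linear_add[OF f])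
  from face_of_convex_coneI[OF V convex_cone_linear_preimage[OF FD(1) V f] _ this]
  show "{x \<in> V. f x \<in> F} face_of V" "{x \<in> V. f x \<in> F} \<noteq> {}"
    by auto
qed

lemma polyhedron_linear_preimage:
  fixes L :: "'b::euclidean_space \<Rightarrow> 'c::euclidean_space"
  assumes "linear L" "polyhedron P"
  shows "polyhedron {x. L x \<in> P}"
proof -
  obtain H where H: "finite H" "P = \<Inter>H" "\<forall>h\<in>H. \<exists>a b. a \<noteq> 0 \<and> h = {y. a \<bullet> y \<le> b}"
    using assms(2) unfolding polyhedron_def by auto
  have "polyhedron {x. L x \<in> h}" if hH: "h \<in> H" for h
  proof -
    obtain a b where h: "h = {y. a \<bullet> y \<le> b}"
      using bspec[OF H(3) hH] by auto
    have "{x. L x \<in> h} = {x. adjoint L a \<bullet> x \<le> b}"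
      unfolding h by (simp add: adjoint_clauses[OF assms(1)])
    then show ?thesis
      by (simp add: polyhedron_halfspace_le)
  qed
  moreover have "{x. L x \<in> P} = (\<Inter>h\<in>H. {x. L x \<in> h})"
    using H(2) by auto
  ultimately show ?thesis
    using H(1) by auto
qed

text \<open>
  The vertices of the polytope cut out by a box around the origin generate the cone, since every
  vector can be scaled into the box.
\<close>

lemma polyhedral_cone_finitely_generated:
  fixes C :: "'b::euclidean_space set"
  assumes P: "polyhedron C" and C: "convex_cone C"
  shows "\<exists>S. finite S \<and> C = convex_cone hull S"
proof -
  have "polytope (C \<inter> cbox (- One) One)"
    using P by (simp add: polytope_eq_bounded_polyhedron bounded_Int)
  then obtain S where S: "finite S" "C \<inter> cbox (- One) One = convex hull S"
    unfolding polytope_def by blast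
  have "S \<subseteq> C"
    using S(2) hull_subset[of S convex] by blast
  then have "convex_cone hull S \<subseteq> C"
    using C by (intro hull_minimal) auto
  moreover have "x \<in> convex_cone hull S" if "x \<in> C" for x
  proof -
    define c where "c = 1 / (1 + norm x)"
    have n: "1 + norm x > 0"
      by (simp add: add_pos_nonneg)
    then have c: "c > 0"
      by (simp add: c_def)
    have "norm (c *\<^sub>R x) \<le> 1"
      using n by (simp add: c_def field_simps)
    then have "c *\<^sub>R x \<in> cbox (- One) One"
      unfolding mem_box using Basis_le_norm[of _ "c *\<^sub>R x"]
      by (fastforce simp: abs_le_iff inner_sum_left_Basis)
    moreover have "c *\<^sub>R x \<in> C"
      using c C that by (intro convex_cone_scaleR) auto
    ultimately have "c *\<^sub>R x \<in> convex_cone hull S"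
      using S(2) convex_hull_subset_convex_cone_hull by blast
    from convex_cone_hull_mul[OF this, of "1 / c"] show ?thesis
      using c by simp
  qed
  ultimately show ?thesis
    using S(1) by blast
qed

lemma fan_convex_cone: "fan \<Gamma> \<Longrightarrow> \<sigma> \<in> \<Gamma> \<Longrightarrow> convex_cone \<sigma>"
  unfolding fan_def using convex_cone_convex_cone_hull by metis

lemma fan_closed:
  fixes \<Gamma> :: "'b::euclidean_space set set"
  shows "fan \<Gamma> \<Longrightarrow> \<sigma> \<in> \<Gamma> \<Longrightarrow> closed \<sigma>"
  unfolding fan_def using closed_convex_cone_hull by metis

text \<open>
  A face \<open>F\<close> of a linear section of a cone \<open>\<sigma>\<close> is the section of a face of \<open>\<sigma>\<close>, namely of the
  smallest one that contains \<open>F\<close>: the summands in \<open>\<sigma>\<close> of elements of \<open>F\<close>.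
\<close>

lemma face_of_linear_section:
  assumes \<sigma>: "convex_cone \<sigma>" and V: "subspace V" and L: "linear L"
    and F: "F face_of {x \<in> V. L x \<in> \<sigma>}" "F \<noteq> {}"
  obtains \<phi> where "\<phi> face_of \<sigma>" "\<phi> \<noteq> {}" "F = {x \<in> V. L x \<in> \<phi>}"
proof -
  have D: "convex_cone {x \<in> V. L x \<in> \<sigma>}"
    using convex_cone_linear_preimage[OF \<sigma> subspace_imp_convex_cone[OF V] L] .
  note FD = face_of_convex_coneD[OF D F]
  define \<phi> where "\<phi> = {y \<in> \<sigma>. \<exists>z\<in>\<sigma>. y + z \<in> L ` F}"
  have LF: "convex_cone (L ` F)"
    using FD(1) L by (intro convex_cone_linear_image) auto
  have "convex_cone \<phi>"
    unfolding convex_cone_iff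
  proof (intro conjI ballI allI impI)
    show "0 \<in> \<phi>"
      using \<sigma> LF by (auto simp: \<phi>_def convex_cone_iff intro!: bexI[of _ 0])
  next
    fix x y assume "x \<in> \<phi>" "y \<in> \<phi>"
    then obtain z w where zw: "x \<in> \<sigma>" "y \<in> \<sigma>" "z \<in> \<sigma>" "w \<in> \<sigma>" "x + z \<in> L ` F" "y + w \<in> L ` F"
      by (auto simp: \<phi>_def)
    then have "(x + z) + (y + w) \<in> L ` F"
      using LF by (simp only: convex_cone_add)
    moreover have "(x + z) + (y + w) = (x + y) + (z + w)"
      by simp
    ultimately have "(x + y) + (z + w) \<in> L ` F"
      by metis
    then show "x + y \<in> \<phi>"
      using convex_cone_add[OF \<sigma>] zw unfolding \<phi>_def by blast
  next
    fix x and c :: real assume "x \<in> \<phi>" "0 \<le> c"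
    then obtain z where z: "x \<in> \<sigma>" "z \<in> \<sigma>" "x + z \<in> L ` F"
      by (auto simp: \<phi>_def)
    have "c *\<^sub>R x + c *\<^sub>R z \<in> L ` F"
      using convex_cone_scaleR[OF LF \<open>0 \<le> c\<close> z(3)] by (simp add: scaleR_add_right)
    then show "c *\<^sub>R x \<in> \<phi>"
      using z \<sigma> \<open>0 \<le> c\<close> unfolding \<phi>_def by (auto intro!: convex_cone_scaleR bexI[of _ "c *\<^sub>R z"])
  qed
  moreover have "u \<in> \<phi>" if u: "u \<in> \<sigma>" "w \<in> \<sigma>" "u + w \<in> \<phi>" for u w
  proof -
    obtain z where z: "z \<in> \<sigma>" "u + w + z \<in> L ` F"
      using u(3) by (auto simp: \<phi>_def)
    have "w + z \<in> \<sigma>"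
      using \<sigma> u(2) z(1) by (rule convex_cone_add)
    then show ?thesis
      using u(1) z(2) unfolding \<phi>_def by (auto simp only: add.assoc)
  qed
  ultimately have "\<phi> face_of \<sigma>" "\<phi> \<noteq> {}"
    using face_of_convex_coneI[OF \<sigma>, of \<phi>] by (auto simp: \<phi>_def)
  moreover have "F = {x \<in> V. L x \<in> \<phi>}"
  proof (intro equalityI subsetI)
    fix x assume "x \<in> F"
    then show "x \<in> {x \<in> V. L x \<in> \<phi>}"
      using FD(2) \<sigma> by (auto simp: \<phi>_def convex_cone_iff intro!: bexI[of _ 0])
  next
    fix x assume "x \<in> {x \<in> V. L x \<in> \<phi>}"
    then obtain z y where x: "x \<in> V" "L x \<in> \<sigma>" and z: "z \<in> \<sigma>" "L x + z = L y" and y: "y \<in> F"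
      by (auto simp: \<phi>_def)
    have "z = L (y - x)"
      using z(2) by (simp add: linear_diff[OF L] algebra_simps)
    moreover have "y - x \<in> V"
      using V FD(2) x y by (auto intro: subspace_diff)
    ultimately show "x \<in> F"
      using FD(3)[of x "y - x"] x y z(1) by simp
  qed
  ultimately show ?thesis
    using that by blast
qed

text \<open>
  Generators of the preimage of a cone cannot be read off from generators of the cone, but linear
  inequalities pull back directly; hence the detour through polyhedra.
\<close>

lemma fan_linear_preimage:
  fixes L :: "'b::euclidean_space \<Rightarrow> 'c::euclidean_space"
  assumes \<Gamma>: "fan \<Gamma>" and V: "subspace V" and L: "linear L"
  shows "fan {{x \<in> V. L x \<in> \<sigma>} | \<sigma>. \<sigma> \<in> \<Gamma>}" (is "fan ?\<Delta>")
  unfolding fan_def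
proof (intro conjI ballI allI impI)
  have cone: "convex_cone {x \<in> V. L x \<in> \<sigma>}" if "\<sigma> \<in> \<Gamma>" for \<sigma>
    using convex_cone_linear_preimage[OF fan_convex_cone[OF \<Gamma> that] subspace_imp_convex_cone[OF V] L] .
  show "finite ?\<Delta>"
    using \<Gamma> by (simp add: fan_def)
  fix D assume "D \<in> ?\<Delta>"
  then obtain \<sigma> where \<sigma>: "\<sigma> \<in> \<Gamma>" and D: "D = {x \<in> V. L x \<in> \<sigma>}"
    by blast
  obtain S where "finite S" "\<sigma> = convex_cone hull S"
    using \<Gamma> \<sigma> by (auto simp: fan_def)
  then have "polyhedron {x. L x \<in> \<sigma>}"
    using polyhedron_linear_preimage[OF L] polyhedron_convex_cone_hull by blast
  then have "polyhedron (V \<inter> {x. L x \<in> \<sigma>})"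
    using affine_imp_polyhedron[OF subspace_imp_affine[OF V]] by (rule polyhedron_Int[rotated])
  moreover have "V \<inter> {x. L x \<in> \<sigma>} = D"
    using D by blast
  ultimately show "\<exists>S. finite S \<and> D = convex_cone hull S"
    using polyhedral_cone_finitely_generated cone[OF \<sigma>] D by metis
  {
    fix F assume "F face_of D" "F \<noteq> {}"
    then obtain \<phi> where "\<phi> face_of \<sigma>" "\<phi> \<noteq> {}" "F = {x \<in> V. L x \<in> \<phi>}"
      using face_of_linear_section[OF fan_convex_cone[OF \<Gamma> \<sigma>] V L] D by metis
    then show "F \<in> ?\<Delta>"
      using \<Gamma> \<sigma> by (auto simp: fan_def)
  }
  fix D' assume "D' \<in> ?\<Delta>"
  then obtain \<tau> where \<tau>: "\<tau> \<in> \<Gamma>" and D': "D' = {x \<in> V. L x \<in> \<tau>}"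
    by blast
  have "\<sigma> \<inter> \<tau> face_of \<sigma>"
    using \<Gamma> \<sigma> \<tau> by (auto simp: fan_def)
  moreover have "0 \<in> \<sigma> \<inter> \<tau>"
    using fan_convex_cone[OF \<Gamma>] \<sigma> \<tau> convex_cone_contains_0 by auto
  ultimately have "{x \<in> D. L x \<in> \<sigma> \<inter> \<tau>} face_of D"
    using face_of_linear_preimage(1)[OF fan_convex_cone[OF \<Gamma> \<sigma>] cone[OF \<sigma>] L] D by blast
  moreover have "{x \<in> D. L x \<in> \<sigma> \<inter> \<tau>} = D \<inter> D'"
    using D D' by blast
  ultimately show "D \<inter> D' face_of D"
    by simp
qed

text \<open>
  The cones that contain a vector \<open>e\<close> form the star of \<open>e\<close>; their images under a map that kills
  exactly the direction \<open>e\<close> form its link.  A face of an image pulls back to a face containing \<open>e\<close>.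
  Two points of the star with the same image differ by a multiple of \<open>e\<close>, so that one of them can be moved onto
  the other inside its cone, and therefore images of intersections are intersections of images.
  For \<open>e = 0\<close> the star is the whole fan, and the map is injective on the support.
\<close>

lemma fan_image_star:
  fixes f :: "'b::real_vector \<Rightarrow> 'c::real_vector"
  assumes \<Gamma>: "fan \<Gamma>" and f: "linear f" and e: "f e = 0"
    and inj: "\<And>x y. x \<in> \<Union>\<Gamma> \<Longrightarrow> y \<in> \<Union>\<Gamma> \<Longrightarrow> f x = f y \<Longrightarrow>
      \<exists>c\<ge>0. x = y + c *\<^sub>R e \<or> y = x + c *\<^sub>R e"
  shows "fan {f ` \<sigma> | \<sigma>. \<sigma> \<in> \<Gamma> \<and> e \<in> \<sigma>}" (is "fan ?\<Delta>")
  unfolding fan_def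
proof (intro conjI ballI allI impI)
  have cone: "convex_cone \<sigma>" "convex_cone (f ` \<sigma>)" if "\<sigma> \<in> \<Gamma>" for \<sigma>
    using fan_convex_cone[OF \<Gamma> that] f by (auto intro: convex_cone_linear_image)
  show "finite ?\<Delta>"
    using \<Gamma> by (simp add: fan_def)
  fix D assume "D \<in> ?\<Delta>"
  then obtain \<sigma> where \<sigma>: "\<sigma> \<in> \<Gamma>" "e \<in> \<sigma>" and D: "D = f ` \<sigma>"
    by blast
  obtain S where "finite S" "\<sigma> = convex_cone hull S"
    using \<Gamma> \<sigma> by (auto simp: fan_def)
  then show "\<exists>S. finite S \<and> D = convex_cone hull S"
    using convex_cone_hull_linear_image[OF f] D by (metis finite_imageI)
  {
    fix F assume F: "F face_of D" "F \<noteq> {}"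
    define \<phi> where "\<phi> = {x \<in> \<sigma>. f x \<in> F}"
    have "\<phi> face_of \<sigma>" "\<phi> \<noteq> {}"
      unfolding \<phi>_def using face_of_linear_preimage[OF _ cone(1)[OF \<sigma>(1)] f F] cone(2)[OF \<sigma>(1)] D
      by auto
    then have "\<phi> \<in> \<Gamma>"
      using \<Gamma> \<sigma> by (auto simp: fan_def)
    moreover have "0 \<in> F"
      using face_of_convex_coneD(1)[OF _ F] cone(2)[OF \<sigma>(1)] D convex_cone_contains_0 by auto
    then have "e \<in> \<phi>"
      using \<sigma>(2) e by (simp add: \<phi>_def)
    moreover have "F = f ` \<phi>"
      using face_of_imp_subset[OF F(1)] D by (auto simp: \<phi>_def)
    ultimately show "F \<in> ?\<Delta>"
      by blast
  }
  fix D' assume "D' \<in> ?\<Delta>"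
  then obtain \<tau> where \<tau>: "\<tau> \<in> \<Gamma>" "e \<in> \<tau>" and D': "D' = f ` \<tau>"
    by blast
  have shift: "x + c *\<^sub>R e \<in> \<rho>" if "x \<in> \<rho>" "e \<in> \<rho>" "c \<ge> 0" "\<rho> \<in> \<Gamma>" for x c \<rho>
    using cone(1)[OF that(4)] that by (intro convex_cone_add convex_cone_scaleR)
  have face: "\<sigma> \<inter> \<tau> face_of \<sigma>"
    using \<Gamma> \<sigma> \<tau> by (auto simp: fan_def)
  have ne: "\<sigma> \<inter> \<tau> \<noteq> {}"
    using \<sigma> \<tau> by blast
  note I = face_of_convex_coneD[OF cone(1)[OF \<sigma>(1)] face ne]
  have shiftI: "x + c *\<^sub>R e \<in> \<sigma> \<inter> \<tau>" if "x \<in> \<sigma> \<inter> \<tau>" "c \<ge> 0" for x c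
    using shift that \<sigma> \<tau> by blast
  have "y \<in> f ` (\<sigma> \<inter> \<tau>)" if y: "y \<in> D" "y \<in> D'" for y
  proof -
    obtain u v where uv: "u \<in> \<sigma>" "v \<in> \<tau>" "y = f u" "y = f v"
      using y D D' by (metis imageE)
    then obtain c where c: "c \<ge> 0" "u = v + c *\<^sub>R e \<or> v = u + c *\<^sub>R e"
      using inj[of u v] \<sigma> \<tau> by auto
    then have "u \<in> \<sigma> \<inter> \<tau> \<or> v \<in> \<sigma> \<inter> \<tau>"
      using shift uv \<sigma> \<tau> by blast
    then show ?thesis
      using uv by blast
  qed
  then have eq: "D \<inter> D' = f ` (\<sigma> \<inter> \<tau>)"
    using D D' by blast
  have summand: "a \<in> f ` (\<sigma> \<inter> \<tau>)" if ab: "a \<in> D" "b \<in> D" "a + b \<in> f ` (\<sigma> \<inter> \<tau>)" for a b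
  proof -
    obtain u v w where uvw: "u \<in> \<sigma>" "v \<in> \<sigma>" "w \<in> \<sigma> \<inter> \<tau>" "a = f u" "b = f v" "a + b = f w"
      using ab D by (metis imageE)
    have "u + v \<in> \<sigma>"
      using uvw cone(1)[OF \<sigma>(1)] by (intro convex_cone_add)
    moreover have "f (u + v) = f w"
      using uvw by (simp add: linear_add[OF f])
    ultimately obtain c where c: "c \<ge> 0" "u + v = w + c *\<^sub>R e \<or> w = u + v + c *\<^sub>R e"
      using inj[of "u + v" w] \<sigma>(1) uvw(3) by auto
    then have "u + v \<in> \<sigma> \<inter> \<tau> \<or> u + (v + c *\<^sub>R e) \<in> \<sigma> \<inter> \<tau>"
      using shiftI[OF uvw(3)] uvw(3) by (auto simp: add.assoc)
    then have "u \<in> \<sigma> \<inter> \<tau>"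
      using I(3) uvw(1,2) shift[OF uvw(2) \<sigma>(2) c(1) \<sigma>(1)] by blast
    then show ?thesis
      using uvw by blast
  qed
  have DI: "convex_cone D" "convex_cone (f ` (\<sigma> \<inter> \<tau>))" "f ` (\<sigma> \<inter> \<tau>) \<subseteq> D"
    using cone(2)[OF \<sigma>(1)] D I(1) f by (auto intro: convex_cone_linear_image)
  show "D \<inter> D' face_of D"
    unfolding eq using DI summand by (rule face_of_convex_coneI(1))
qed

section \<open>Joins of nested sets\<close>

lemma building_setD:
  assumes "building_set G"
  shows "bot \<notin> G" "top \<in> G"
    and "f \<noteq> bot \<Longrightarrow> f \<notin> G \<Longrightarrow> interval_is_product f (max_below G f)"
  using assms by (auto simp: building_set_def)

lemma le_max_below:
  assumes "g \<in> G" "g \<le> f"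
  obtains m where "m \<in> max_below G f" "g \<le> m"
proof -
  obtain m where m: "m \<in> {h \<in> G. h \<le> f}" "g \<le> m"
    "\<forall>h\<in>{h \<in> G. h \<le> f}. m \<le> h \<longrightarrow> m = h"
    using finite_has_maximal2[of "{h \<in> G. h \<le> f}" g] assms by auto
  then have "m \<in> max_below G f"
    unfolding max_below_def by (auto simp: less_le)
  then show ?thesis
    using that m(2) by blast
qed

text \<open>
  The family that is \<open>x\<close> at \<open>m\<close> and \<open>bot\<close> elsewhere and the same family for \<open>m'\<close> have the same join,
  so injectivity of the join map identifies them.
\<close>

lemma interval_is_product_disjoint:
  assumes prod: "interval_is_product f M"
    and m: "m \<in> M" "m' \<in> M" "m \<noteq> m'" and x: "x \<le> m" "x \<le> m'"
  shows "x = bot"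
proof -
  define h where "h k = (\<lambda>i\<in>M. if i = k then x else bot)" for k
  have "h m \<in> (\<Pi>\<^sub>E g\<in>M. {bot..g})" "h m' \<in> (\<Pi>\<^sub>E g\<in>M. {bot..g})"
    using x by (auto simp: h_def)
  moreover have "(SUP g\<in>M. h k g) = x" if "k \<in> M" for k
    using that by (intro antisym SUP_least SUP_upper2[of k]) (auto simp: h_def)
  ultimately have "h m = h m'"
    using prod m unfolding interval_is_product_def bij_betw_def inj_on_def by simp
  then have "h m m = h m' m"
    by simp
  then show ?thesis
    using m by (simp add: h_def)
qed

text \<open>
  The family of the tops of the factors is the only one whose join is \<open>f\<close>.
\<close>

lemma interval_is_product_Sup:
  assumes prod: "interval_is_product f M"
    and h: "\<And>m. m \<in> M \<Longrightarrow> h m \<le> m" "f \<le> (SUP m\<in>M. h m)" and m: "m \<in> M"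
  shows "h m = m"
proof -
  define h' where "h' = restrict h M"
  define i where "i = restrict (\<lambda>m. m) M"
  have mem: "h' \<in> (\<Pi>\<^sub>E g\<in>M. {bot..g})" "i \<in> (\<Pi>\<^sub>E g\<in>M. {bot..g})"
    using h by (auto simp: h'_def i_def)
  have "(SUP g\<in>M. i g) \<in> {bot..f}"
    using prod mem(2) unfolding interval_is_product_def bij_betw_def by blast
  moreover have "(SUP g\<in>M. h' g) = (SUP g\<in>M. h g)"
    by (simp add: h'_def)
  moreover have "(SUP g\<in>M. h' g) \<le> (SUP g\<in>M. i g)"
    using h(1) by (intro SUP_mono) (auto simp: h'_def i_def)
  ultimately have "(SUP g\<in>M. h' g) = (SUP g\<in>M. i g)"
    using h(2) by auto
  then have "h' = i"
    using prod mem unfolding interval_is_product_def bij_betw_def inj_on_def by blast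
  then have "h' m = i m"
    by simp
  then show ?thesis
    using m by (simp add: h'_def i_def)
qed

lemma nestedD:
  assumes "nested G N"
  shows "N \<subseteq> G"
    and "A \<subseteq> N \<Longrightarrow> card A \<ge> 2 \<Longrightarrow> pairwise (\<lambda>f g. \<not> f \<le> g \<and> \<not> g \<le> f) A \<Longrightarrow> Sup A \<notin> G"
  using assms by (auto simp: nested_def)

lemma nested_subset: "nested G N \<Longrightarrow> N' \<subseteq> N \<Longrightarrow> nested G N'"
  by (auto simp: nested_def)

text \<open>
  Every element is comparable with \<open>top\<close>, so an antichain with two elements cannot contain it.
\<close>

lemma nested_insert_top:
  assumes "top \<in> G" "nested G N"
  shows "nested G (insert top N)"
  unfolding nested_def
proof (intro conjI allI impI)
  show "insert top N \<subseteq> G"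
    using assms nestedD(1) by blast
  fix A assume A: "A \<subseteq> insert top N" "2 \<le> card A" "pairwise (\<lambda>f g. \<not> f \<le> g \<and> \<not> g \<le> f) A"
  have "top \<notin> A"
  proof
    assume t: "top \<in> A"
    have "A = {top}"
      using pairwiseD[OF A(3) t] t by auto
    then show False
      using A(2) by simp
  qed
  then show "Sup A \<notin> G"
    using A assms nestedD(2)[of G N A] by blast
qed

text \<open>
  An antichain \<open>A\<close> in a nested set consists of the factors of its join.  Each \<open>a \<in> A\<close> lies below some
  factor \<open>m\<close> of the join, and by the product decomposition \<open>m\<close> is the join of those \<open>a\<close> that lie below it.  As
  \<open>m\<close> is in \<open>G\<close> and \<open>A\<close> is nested, there is just one such \<open>a\<close>, so \<open>m = a\<close>.
\<close>

lemma max_below_Sup_nested: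
  assumes G: "building_set G" and N: "nested G N"
    and A: "A \<subseteq> N" "card A \<ge> 2" "pairwise (\<lambda>f g. \<not> f \<le> g \<and> \<not> g \<le> f) A"
  shows "max_below G (Sup A) = A"
proof -
  let ?M = "max_below G (Sup A)"
  have AG: "A \<subseteq> G"
    using A(1) nestedD(1)[OF N] by blast
  have "Sup A \<notin> G"
    using nestedD(2)[OF N A] .
  moreover have "Sup A \<noteq> bot"
  proof
    assume "Sup A = bot"
    then have "A \<subseteq> {bot}"
      by auto
    then have "A = {}"
      using AG building_setD(1)[OF G] by blast
    then show False
      using A(2) by simp
  qed
  ultimately have prod: "interval_is_product (Sup A) ?M"
    using building_setD(3)[OF G] by blast
  define B where "B m = {a \<in> A. a \<le> m}" for m
  have "a \<le> (SUP m\<in>?M. Sup (B m))" if a: "a \<in> A" for a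
  proof -
    obtain m where "m \<in> ?M" "a \<le> m"
      using le_max_below[of a G "Sup A"] a AG by (auto intro: Sup_upper)
    then show ?thesis
      using a by (intro SUP_upper2[of m]) (auto simp: B_def intro: Sup_upper)
  qed
  then have "Sup A \<le> (SUP m\<in>?M. Sup (B m))"
    by (rule Sup_least)
  then have SupB: "Sup (B m) = m" if "m \<in> ?M" for m
    using interval_is_product_Sup[OF prod, of "\<lambda>m. Sup (B m)"] that
    by (auto simp: B_def intro: Sup_least)
  have MA: "m \<in> A" if m: "m \<in> ?M" for m
  proof -
    have mG: "m \<in> G"
      using m by (simp add: max_below_def)
    have "pairwise (\<lambda>f g. \<not> f \<le> g \<and> \<not> g \<le> f) (B m)" "B m \<subseteq> N"
      using A by (auto simp: B_def pairwise_def)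
    then have "\<not> card (B m) \<ge> 2"
      using nestedD(2)[OF N, of "B m"] SupB[OF m] mG by auto
    moreover have "B m \<noteq> {}"
      using SupB[OF m] mG building_setD(1)[OF G] by auto
    moreover have "finite (B m)"
      by simp
    ultimately have "card (B m) = 1"
      using card_gt_0_iff[of "B m"] by linarith
    then obtain a where "B m = {a}"
      by (auto simp: card_1_singleton_iff)
    then show ?thesis
      using SupB[OF m] by (auto simp: B_def)
  qed
  have "a \<in> ?M" if a: "a \<in> A" for a
  proof -
    obtain m where m: "m \<in> ?M" "a \<le> m"
      using le_max_below[of a G "Sup A"] a AG by (auto intro: Sup_upper)
    then have "m = a"
      using pairwiseD[OF A(3) a MA[OF m(1)]] by auto
    then show ?thesis
      using m(1) by simp
  qed
  with MA show ?thesis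
    by blast
qed

text \<open>
  Two incomparable members of a nested set are the factors of their join, hence have meet \<open>bot\<close>.
\<close>

lemma nested_comparable:
  assumes G: "building_set G" and N: "nested G N"
    and fg: "f \<in> N" "g \<in> N" and x: "x \<noteq> bot" "x \<le> f" "x \<le> g"
  shows "f \<le> g \<or> g \<le> f"
proof (rule ccontr)
  assume *: "\<not> (f \<le> g \<or> g \<le> f)"
  then have ne: "f \<noteq> g"
    by auto
  have A: "{f, g} \<subseteq> N" "card {f, g} \<ge> 2" "pairwise (\<lambda>f g. \<not> f \<le> g \<and> \<not> g \<le> f) {f, g}"
    using fg * ne by (auto simp: pairwise_def)
  have "Sup {f, g} \<noteq> bot"
    using x by (auto simp: sup_eq_bot_iff dest: le_bot)
  from building_setD(3)[OF G this nestedD(2)[OF N A]]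
  have "interval_is_product (Sup {f, g}) {f, g}"
    unfolding max_below_Sup_nested[OF G N A] .
  then show False
    using interval_is_product_disjoint[of "Sup {f, g}" "{f, g}" f g x] ne x by auto
qed

text \<open>
  The maximal members of \<open>S\<close> have the same join as \<open>S\<close> and, unless there is only one, are its factors; an element of \<open>G\<close> below the
  join lies below one of the factors.
\<close>

lemma le_Sup_nested:
  assumes G: "building_set G" and N: "nested G N" and S: "S \<subseteq> N"
    and g: "g \<in> G" "g \<le> Sup S"
  obtains s where "s \<in> S" "g \<le> s"
proof -
  define A where "A = {a \<in> S. \<forall>b\<in>S. a \<le> b \<longrightarrow> a = b}"
  have "\<exists>a\<in>A. s \<le> a" if "s \<in> S" for s
    using finite_has_maximal2[of S s] that by (auto simp: A_def)
  then have "Sup S \<le> Sup A"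
    by (intro Sup_mono)
  then have gA: "g \<le> Sup A"
    using g(2) by simp
  have A: "A \<subseteq> N" "pairwise (\<lambda>f g. \<not> f \<le> g \<and> \<not> g \<le> f) A" "A \<subseteq> S"
    using S by (auto simp: A_def pairwise_def)
  have "\<exists>s\<in>A. g \<le> s"
  proof (cases "card A \<ge> 2")
    case True
    obtain m where "m \<in> max_below G (Sup A)" "g \<le> m"
      using le_max_below[OF g(1) gA] .
    then show ?thesis
      unfolding max_below_Sup_nested[OF G N A(1) True A(2)] by blast
  next
    case False
    have "A \<noteq> {}"
      using gA g(1) building_setD(1)[OF G] by (auto dest: le_bot)
    moreover have "finite A"
      by simp
    ultimately have "card A = 1"
      using False card_gt_0_iff[of A] by linarith
    then obtain a where "A = {a}"
      by (auto simp: card_1_singleton_iff)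
    then show ?thesis
      using gA by simp
  qed
  then show ?thesis
    using that A(3) by blast
qed

section \<open>Injectivity of \<open>p\<close> on the nested cones\<close>

lemma convex_cone_nested_cone: "convex_cone (nested_cone N)"
  unfolding nested_cone_def by (rule convex_cone_convex_cone_hull)

lemma basis_vec_nth: "basis_vec f $ g = (if g = f then 1 else 0)"
  by (simp add: basis_vec_def axis_def)

lemma vec_eq_sum_basis_vec: "x = (\<Sum>f\<in>UNIV. x $ f *\<^sub>R basis_vec f)"
  by (simp add: vec_eq_iff basis_vec_nth if_distrib cong: if_cong)

lemma nested_cone_iff:
  "x \<in> nested_cone N \<longleftrightarrow> (\<forall>f. 0 \<le> x $ f) \<and> (\<forall>f. f \<notin> N \<longrightarrow> x $ f = 0)"
proof
  assume "x \<in> nested_cone N"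
  moreover have "convex_cone {x :: 'a rvec. (\<forall>f. 0 \<le> x $ f) \<and> (\<forall>f. f \<notin> N \<longrightarrow> x $ f = 0)}"
    by (simp add: convex_cone_iff)
  then have "nested_cone N \<subseteq> {x. (\<forall>f. 0 \<le> x $ f) \<and> (\<forall>f. f \<notin> N \<longrightarrow> x $ f = 0)}"
    unfolding nested_cone_def
    by (intro hull_minimal) (auto simp: basis_vec_nth)
  ultimately show "(\<forall>f. 0 \<le> x $ f) \<and> (\<forall>f. f \<notin> N \<longrightarrow> x $ f = 0)"
    by blast
next
  assume x: "(\<forall>f. 0 \<le> x $ f) \<and> (\<forall>f. f \<notin> N \<longrightarrow> x $ f = 0)"
  have "(\<Sum>f\<in>UNIV. x $ f *\<^sub>R basis_vec f) \<in> nested_cone N"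
  proof (rule convex_cone_sum[OF convex_cone_nested_cone])
    fix f
    show "x $ f *\<^sub>R basis_vec f \<in> nested_cone N"
    proof (cases "f \<in> N")
      case True
      then have "basis_vec f \<in> nested_cone N"
        unfolding nested_cone_def by (intro hull_inc) simp
      then show ?thesis
        using x by (intro convex_cone_scaleR[OF convex_cone_nested_cone]) auto
    next
      case False
      then show ?thesis
        using x convex_cone_contains_0[OF convex_cone_nested_cone] by simp
    qed
  qed
  then show "x \<in> nested_cone N"
    using vec_eq_sum_basis_vec[of x] by simp
qed

text \<open>
  At an atom these sums are the coordinates of the image under \<open>p\<close>.
\<close>

definition upper_sum :: "'a::{finite,complete_lattice} set \<Rightarrow> 'a rvec \<Rightarrow> 'a \<Rightarrow> real" where
  "upper_sum G x g = (\<Sum>f\<in>{f\<in>G. g \<le> f}. x $ f)"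

lemma p_map_nth_atom:
  fixes e :: "'a::{finite,complete_lattice}"
  assumes "e \<in> atoms"
  shows "p_map G x $ e = upper_sum G x e"
proof -
  have *: "(\<Sum>e'\<in>{e' \<in> atoms. e' \<le> f}. basis_vec e' $ e) = (if e \<le> f then 1 else (0::real))" for f :: 'a
    using assms by (simp add: basis_vec_nth sum.delta)
  have "p_map G x $ e = (\<Sum>f\<in>G. if e \<le> f then x $ f else 0)"
    by (simp add: p_map_def * if_distrib cong: if_cong)
  then show ?thesis
    by (simp add: upper_sum_def sum.inter_filter)
qed

lemma upper_sum_antimono:
  assumes "\<And>f. 0 \<le> x $ f" "g \<le> g'"
  shows "upper_sum G x g' \<le> upper_sum G x g"
  unfolding upper_sum_def using assms by (intro sum_mono2) auto

text \<open>
  Moebius inversion: at a maximal element of \<open>G\<close> where \<open>x\<close> and \<open>y\<close> differ, the sums differ as well.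
\<close>

lemma upper_sum_inj:
  assumes eq: "\<And>g. g \<in> G \<Longrightarrow> upper_sum G x g = upper_sum G y g" and g: "g \<in> G"
  shows "x $ g = y $ g"
proof (rule ccontr)
  assume "x $ g \<noteq> y $ g"
  then obtain m where m: "m \<in> {f \<in> G. x $ f \<noteq> y $ f}"
    "\<And>f. f \<in> {f \<in> G. x $ f \<noteq> y $ f} \<Longrightarrow> m \<le> f \<Longrightarrow> m = f"
    using finite_has_maximal2[of "{f \<in> G. x $ f \<noteq> y $ f}" g] g by auto
  have "0 = upper_sum G x m - upper_sum G y m"
    using eq m(1) by simp
  also have "\<dots> = (\<Sum>f\<in>{f\<in>G. m \<le> f}. x $ f - y $ f)"
    by (simp add: upper_sum_def sum_subtractf)
  also have "\<dots> = (\<Sum>f\<in>{m}. x $ f - y $ f)"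
    using m by (intro sum.mono_neutral_right) auto
  finally show False
    using m(1) by simp
qed

text \<open>
  The upper sums of \<open>x\<close> at all elements of \<open>G\<close> can be read off from the superlevel sets of \<open>p x\<close>.  If the
  upper sum at \<open>g\<close> is at least \<open>t\<close>, so is the one at every atom below \<open>g\<close>, and \<open>g\<close> is the join of these
  atoms.  Conversely, the members of \<open>N\<close> above an atom form a chain, so the value at an atom is already
  the upper sum at a member of \<open>N\<close> above it.  Thus the join of the superlevel set lies below the join of the
  members of \<open>N\<close> with upper sum at least \<open>t\<close>, and \<open>g\<close> must lie below one of them.
\<close>

lemma upper_sum_ge_iff:
  fixes G :: "'a::{finite,complete_lattice} set"
  assumes atomic: "\<And>f::'a. f = Sup {e \<in> atoms. e \<le> f}"
    and G: "building_set G" and N: "nested G N" and x: "x \<in> nested_cone N"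
    and g: "g \<in> G" and t: "0 < t"
  shows "t \<le> upper_sum G x g \<longleftrightarrow> g \<le> Sup {e \<in> atoms. t \<le> p_map G x $ e}"
proof
  have x0: "0 \<le> x $ f" "f \<notin> N \<Longrightarrow> x $ f = 0" for f
    using x by (auto simp: nested_cone_iff)
  {
    assume "t \<le> upper_sum G x g"
    then have "{e \<in> atoms. e \<le> g} \<subseteq> {e \<in> atoms. t \<le> p_map G x $ e}"
      using upper_sum_antimono[of x _ g G] x0(1) by (auto simp: p_map_nth_atom intro: order_trans)
    then show "g \<le> Sup {e \<in> atoms. t \<le> p_map G x $ e}"
      by (subst atomic[of g]) (rule Sup_subset_mono)
  next
    assume gS: "g \<le> Sup {e \<in> atoms. t \<le> p_map G x $ e}"
    define S where "S = {h \<in> N. t \<le> upper_sum G x h}"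
    have "\<exists>h\<in>S. e \<le> h" if e: "e \<in> atoms" "t \<le> p_map G x $ e" for e
    proof -
      let ?C = "{h \<in> N. e \<le> h}"
      have eb: "e \<noteq> bot"
        using e(1) by (auto simp: atoms_def)
      have sum: "upper_sum G x h = (\<Sum>f\<in>{f \<in> N. h \<le> f}. x $ f)" for h
        unfolding upper_sum_def using x0(2) nestedD(1)[OF N]
        by (intro sum.mono_neutral_right) auto
      have te: "t \<le> upper_sum G x e"
        using e p_map_nth_atom by metis
      have "?C \<noteq> {}"
      proof
        assume empty: "?C = {}"
        show False
          using te t unfolding sum empty by simp
      qed
      then obtain h where h: "h \<in> ?C" "\<And>f. f \<in> ?C \<Longrightarrow> f \<le> h \<Longrightarrow> h = f"
        using finite_has_minimal[of ?C] by auto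
      \<comment> \<open>\<open>?C\<close> is a chain, so its minimal element \<open>h\<close> is below every member of \<open>?C\<close>.\<close>
      have "h \<le> f" if "f \<in> ?C" for f
        using nested_comparable[OF G N, of h f e] h that eb by auto
      then have "{f \<in> N. h \<le> f} = ?C"
        using h(1) by auto
      then have "upper_sum G x h = upper_sum G x e"
        by (simp add: sum)
      then show ?thesis
        using te h(1) by (auto simp: S_def)
    qed
    then have "Sup {e \<in> atoms. t \<le> p_map G x $ e} \<le> Sup S"
      by (intro Sup_mono) auto
    then have "g \<le> Sup S"
      using gS by simp
    then obtain s where "s \<in> S" "g \<le> s"
      using le_Sup_nested[OF G N _ g, of S] by (auto simp: S_def)
    then show "t \<le> upper_sum G x g"
      using upper_sum_antimono[of x g s G] x0(1) by (auto simp: S_def)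
  }
qed

text \<open>
  The cones \<open>p (nested_cone N)\<close> overlap only in common faces: a vector in their union determines its
  preimage, because it determines the upper sums.
\<close>

lemma p_map_inj_nested:
  fixes G :: "'a::{finite,complete_lattice} set"
  assumes atomic: "\<And>f::'a. f = Sup {e \<in> atoms. e \<le> f}" and G: "building_set G"
    and x: "nested G N" "x \<in> nested_cone N" and y: "nested G N'" "y \<in> nested_cone N'"
    and eq: "p_map G x = p_map G y"
  shows "x = y"
proof -
  have pos: "0 \<le> upper_sum G x g" "0 \<le> upper_sum G y g" for g
    using x y by (auto simp: upper_sum_def nested_cone_iff intro!: sum_nonneg)
  have "upper_sum G x g = upper_sum G y g" if g: "g \<in> G" for g
  proof -
    have "t \<le> upper_sum G x g \<longleftrightarrow> t \<le> upper_sum G y g" if "0 < t" for t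
      using upper_sum_ge_iff[OF atomic G x g that] upper_sum_ge_iff[OF atomic G y g that] eq by simp
    then show ?thesis
      using pos[of g] by (metis antisym order.order_iff_strict)
  qed
  then have "x $ g = y $ g" if "g \<in> G" for g
    using upper_sum_inj that by blast
  moreover have "x $ g = y $ g" if "g \<notin> G" for g
    using that x y nestedD(1)[OF x(1)] nestedD(1)[OF y(1)] by (metis nested_cone_iff subsetD)
  ultimately show ?thesis
    by (auto simp: vec_eq_iff)
qed

section \<open>The cones of the doubled fan and of the universe fan on the diagonal\<close>

text \<open>
  A nonnegative vector is the sum of its components along the basis, all of which lie in any
  face that contains the vector.
\<close>

lemma face_of_nested_cone:
  assumes "T face_of nested_cone N" "T \<noteq> {}"
  obtains A where "A \<subseteq> N" "T = nested_cone A"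
proof -
  note TD = face_of_convex_coneD[OF convex_cone_nested_cone assms]
  define A where "A = {f \<in> N. basis_vec f \<in> T}"
  have "x \<in> nested_cone A" if x: "x \<in> T" for x
  proof -
    have xN: "0 \<le> x $ f" "f \<notin> N \<Longrightarrow> x $ f = 0" for f
      using TD(2) x by (auto simp: nested_cone_iff)
    have "f \<in> A" if f: "x $ f \<noteq> 0" for f
    proof -
      have "x $ f *\<^sub>R basis_vec f \<in> nested_cone N" "x - x $ f *\<^sub>R basis_vec f \<in> nested_cone N"
        using xN f by (auto simp: nested_cone_iff basis_vec_nth)
      then have "x $ f *\<^sub>R basis_vec f \<in> T"
        using TD(3)[of "x $ f *\<^sub>R basis_vec f" "x - x $ f *\<^sub>R basis_vec f"] x by simp
      from convex_cone_scaleR[OF TD(1) _ this, of "1 / x $ f"] have "basis_vec f \<in> T"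
        using xN(1)[of f] f by simp
      then show ?thesis
        using xN f by (auto simp: A_def)
    qed
    then show ?thesis
      using xN by (auto simp: nested_cone_iff)
  qed
  moreover have "nested_cone A \<subseteq> T"
    unfolding nested_cone_def using TD(1) by (intro hull_minimal) (auto simp: A_def)
  ultimately have "T = nested_cone A"
    by blast
  moreover have "A \<subseteq> N"
    by (auto simp: A_def)
  ultimately show ?thesis
    using that by blast
qed

lemma convex_cone_doubled_cone: "convex_cone (doubled_cone N)"
  unfolding doubled_cone_def by (rule convex_cone_convex_cone_hull)

lemma doubled_cone_eq: "doubled_cone N = nested_cone N \<times> nested_cone N"
proof -
  have "linear (\<lambda>v :: 'a rvec. (v, 0 :: 'a rvec))" "linear (\<lambda>v :: 'a rvec. (0 :: 'a rvec, v))"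
    by (auto intro!: linearI)
  note L = convex_cone_hull_linear_image[OF this(1)] convex_cone_hull_linear_image[OF this(2)]
  have "plus_vec ` N = (\<lambda>v. (v, 0)) ` basis_vec ` N" "minus_vec ` N = (\<lambda>v. (0, v)) ` basis_vec ` N"
    by (auto simp: image_image plus_vec_def minus_vec_def basis_vec_def)
  then have "doubled_cone N =
      (\<Union>x\<in>(\<lambda>v. (v, 0)) ` nested_cone N. \<Union>y\<in>(\<lambda>v. (0, v)) ` nested_cone N. {x + y})"
    unfolding doubled_cone_def convex_cone_hull_Un nested_cone_def by (simp only: L)
  then show ?thesis
    by auto
qed

lemma Delta0_nth:
  "fst (Delta0 G x) $ f = (if f \<in> G then x $ f else 0)"
  "snd (Delta0 G x) $ f = (if f \<in> G \<and> f \<noteq> top then x $ f else 0)"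
proof -
  have "fst (Delta0 G x) $ f = (\<Sum>g\<in>G. if g = f then x $ f else 0)"
    unfolding Delta0_def fst_sum sum_component
    by (intro sum.cong) (auto simp: plus_vec_def minus_vec_def axis_def)
  then show "fst (Delta0 G x) $ f = (if f \<in> G then x $ f else 0)"
    by simp
  have "snd (Delta0 G x) $ f = (\<Sum>g\<in>G. if g = f then (if f \<noteq> top then x $ f else 0) else 0)"
    unfolding Delta0_def snd_sum sum_component
    by (intro sum.cong) (auto simp: plus_vec_def minus_vec_def axis_def)
  then show "snd (Delta0 G x) $ f = (if f \<in> G \<and> f \<noteq> top then x $ f else 0)"
    by simp
qed

lemma linear_Delta0: "linear (Delta0 G)"
  by (intro linearI) (auto simp: prod_eq_iff vec_eq_iff Delta0_nth)

lemma subspace_space_on: "subspace (space_on G)"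
  by (auto simp: subspace_def space_on_def)

lemma nested_cone_subset_space_on: "N \<subseteq> G \<Longrightarrow> nested_cone N \<subseteq> space_on G"
  unfolding nested_cone_iff space_on_def subset_iff mem_Collect_eq by blast

lemma Delta0_mem_doubled_cone:
  assumes "x \<in> space_on G" "N \<subseteq> G"
  shows "Delta0 G x \<in> doubled_cone N \<longleftrightarrow> x \<in> nested_cone N"
proof -
  have "x $ f = fst (Delta0 G x) $ f" for f
    using assms(1) by (auto simp: Delta0_nth space_on_def)
  then have fst: "x = fst (Delta0 G x)"
    by (simp add: vec_eq_iff)
  have "snd (Delta0 G x) \<in> nested_cone N" if "x \<in> nested_cone N"
    using that by (auto simp: nested_cone_iff Delta0_nth)
  then show ?thesis
    unfolding doubled_cone_eq mem_Times_iff using fst by auto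
qed

text \<open>
  Linear preimages of faces are faces, and the faces of the orthant \<open>nested_cone N\<close> are its coordinate
  faces.
\<close>

lemma Delta0_preimage_face_doubled_cone:
  assumes N: "nested G N" and \<tau>: "\<tau> face_of doubled_cone N" "\<tau> \<noteq> {}"
  obtains A where "nested G A" "{x \<in> space_on G. Delta0 G x \<in> \<tau>} = nested_cone A"
proof -
  have NG: "N \<subseteq> G"
    using nestedD(1)[OF N] .
  have sub: "Delta0 G ` nested_cone N \<subseteq> doubled_cone N"
    using nested_cone_subset_space_on[OF NG] Delta0_mem_doubled_cone[OF _ NG] by blast
  obtain A where A: "A \<subseteq> N" "{x \<in> nested_cone N. Delta0 G x \<in> \<tau>} = nested_cone A"
    using face_of_nested_cone[OF face_of_linear_preimage[OF convex_cone_doubled_cone convex_cone_nested_cone linear_Delta0 \<tau> sub]]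
    by blast
  have "{x \<in> space_on G. Delta0 G x \<in> \<tau>} = {x \<in> nested_cone N. Delta0 G x \<in> \<tau>}"
    using Delta0_mem_doubled_cone[OF _ NG] face_of_imp_subset[OF \<tau>(1)]
      nested_cone_subset_space_on[OF NG] by blast
  then show ?thesis
    using that[of A] A nested_subset[OF N] by auto
qed

lemma Delta0_preimage_doubled_fan:
  "Delta0_preimage G (doubled_fan G) = {nested_cone N | N. nested G N}"
proof (intro equalityI subsetI)
  fix D assume "D \<in> Delta0_preimage G (doubled_fan G)"
  then obtain N \<tau> where "nested G N" "\<tau> face_of doubled_cone N" "\<tau> \<noteq> {}"
    "D = {x \<in> space_on G. Delta0 G x \<in> \<tau>}"
    by (auto simp: Delta0_preimage_def doubled_fan_def)
  then show "D \<in> {nested_cone N | N. nested G N}"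
    using Delta0_preimage_face_doubled_cone[of G N \<tau>] by blast
next
  fix D assume "D \<in> {nested_cone N | N. nested G N}"
  then obtain N where N: "nested G N" "D = nested_cone N"
    by blast
  have "doubled_cone N \<in> doubled_fan G"
    using N(1) convex_cone_doubled_cone[of N] unfolding doubled_fan_def by (auto intro: face_of_refl simp: convex_cone_def)
  moreover have "D = {x \<in> space_on G. Delta0 G x \<in> doubled_cone N}"
    using N Delta0_mem_doubled_cone[OF _ nestedD(1)[OF N(1)]]
      nested_cone_subset_space_on[OF nestedD(1)[OF N(1)]] by blast
  ultimately show "D \<in> Delta0_preimage G (doubled_fan G)"
    unfolding Delta0_preimage_def by blast
qed

text \<open>
  The inequalities \<open>F\<^sub>g \<ge> 0\<close> on the image of \<open>Delta0\<close>: there \<open>p\<^sub>f - m\<^sub>f\<close> vanishes for \<open>f < top\<close>, and what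
  remains of \<open>F\<^sub>g\<close> is \<open>x\<^bsub>top\<^esub> - x\<^sub>g\<close>.
\<close>

definition top_dominated :: "'a::{finite,complete_lattice} rvec set" where
  "top_dominated = {x. \<forall>f. x $ f \<le> x $ top}"

lemma convex_cone_top_dominated: "convex_cone top_dominated"
  by (auto simp: convex_cone_iff top_dominated_def add_mono mult_left_mono)

lemma Delta0_mem_causal_cone:
  assumes "top \<in> G" "x \<in> space_on G"
  shows "Delta0 G x \<in> causal_cone G \<longleftrightarrow> x \<in> nested_cone G \<inter> top_dominated"
proof -
  have F: "F_coord G g (Delta0 G x) = x $ top - (if g = top then 0 else x $ g)" if "g \<in> G" for g
  proof -
    have "(\<Sum>f\<in>{f \<in> G. g < f \<and> f < top}. fst (Delta0 G x) $ f - snd (Delta0 G x) $ f) = 0"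
      by (intro sum.neutral) (auto simp: Delta0_nth)
    then show ?thesis
      using assms(1) that unfolding F_coord_def by (simp add: Delta0_nth)
  qed
  have "Delta0 G x \<in> space_on G \<times> space_on G"
    by (auto simp: mem_Times_iff space_on_def Delta0_nth)
  then have "Delta0 G x \<in> causal_cone G \<longleftrightarrow> (\<forall>g\<in>G. 0 \<le> x $ g \<and> x $ g \<le> x $ top)"
    using assms(1) unfolding causal_cone_def by (auto simp: Delta0_nth F)
  also have "\<dots> \<longleftrightarrow> x \<in> nested_cone G \<inter> top_dominated"
    using assms unfolding Int_iff nested_cone_iff top_dominated_def space_on_def mem_Collect_eq
    by (metis order_refl)
  finally show ?thesis .
qed

lemma Delta0_preimage_section:
  assumes "top \<in> G" "{x \<in> space_on G. Delta0 G x \<in> \<sigma>} = nested_cone N" "N \<subseteq> G"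
  shows "{x \<in> space_on G. Delta0 G x \<in> \<sigma> \<inter> causal_cone G} = nested_cone N \<inter> top_dominated"
proof -
  have "nested_cone N \<subseteq> nested_cone G"
    using assms(3) unfolding nested_cone_iff subset_iff by blast
  then show ?thesis
    using assms(2) Delta0_mem_causal_cone[OF assms(1)] by blast
qed

lemma Delta0_preimage_causal_sections:
  assumes "top \<in> G"
  shows "Delta0_preimage G (causal_sections G) = {nested_cone N \<inter> top_dominated | N. nested G N}"
proof (intro equalityI subsetI)
  fix D assume "D \<in> Delta0_preimage G (causal_sections G)"
  then obtain \<sigma> where \<sigma>: "\<sigma> \<in> doubled_fan G"
    "D = {x \<in> space_on G. Delta0 G x \<in> \<sigma> \<inter> causal_cone G}"
    by (auto simp: Delta0_preimage_def causal_sections_def)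
  then have "{x \<in> space_on G. Delta0 G x \<in> \<sigma>} \<in> Delta0_preimage G (doubled_fan G)"
    by (auto simp: Delta0_preimage_def)
  then obtain N where "nested G N" "{x \<in> space_on G. Delta0 G x \<in> \<sigma>} = nested_cone N"
    unfolding Delta0_preimage_doubled_fan by blast
  then show "D \<in> {nested_cone N \<inter> top_dominated | N. nested G N}"
    using Delta0_preimage_section[OF assms] \<sigma>(2) nestedD(1) by blast
next
  fix D assume "D \<in> {nested_cone N \<inter> top_dominated | N. nested G N}"
  then obtain N where N: "nested G N" "D = nested_cone N \<inter> top_dominated"
    by blast
  then have "nested_cone N \<in> Delta0_preimage G (doubled_fan G)"
    unfolding Delta0_preimage_doubled_fan by blast
  then obtain \<sigma> where "\<sigma> \<in> doubled_fan G" "{x \<in> space_on G. Delta0 G x \<in> \<sigma>} = nested_cone N"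
    by (auto simp: Delta0_preimage_def)
  then show "D \<in> Delta0_preimage G (causal_sections G)"
    using Delta0_preimage_section[OF assms _ nestedD(1)[OF N(1)]] N(2)
    unfolding Delta0_preimage_def causal_sections_def by blast
qed

lemma convex_cone_causal_cone: "convex_cone (causal_cone G)"
proof -
  have "F_coord G g (v + w) = F_coord G g v + F_coord G g w"
    "F_coord G g (c *\<^sub>R v) = c * F_coord G g v" for g v w c
    by (simp_all add: F_coord_def algebra_simps sum.distrib sum_subtractf sum_distrib_left)
  moreover have "F_coord G g 0 = 0" for g
    by (simp add: F_coord_def)
  ultimately show ?thesis
    using subspace_space_on[of G]
    by (auto simp: convex_cone_iff causal_cone_def subspace_def mem_Times_iff)
qed

lemma convex_cone_causal_sections:
  assumes "\<sigma> \<in> causal_sections G"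
  shows "convex_cone \<sigma>"
proof -
  obtain N \<tau> where \<tau>: "\<tau> face_of doubled_cone N" "\<tau> \<noteq> {}" "\<sigma> = \<tau> \<inter> causal_cone G"
    using assms by (auto simp: causal_sections_def doubled_fan_def)
  have "convex_cone \<tau>"
    using face_of_convex_coneD(1)[OF convex_cone_doubled_cone \<tau>(1,2)] .
  then show ?thesis
    using convex_cone_causal_cone[of G] \<tau>(3) by (auto simp: convex_cone_iff)
qed

lemma causal_sections_subset_universe_fan: "causal_sections G \<subseteq> universe_fan G"
proof
  fix \<sigma> assume \<sigma>: "\<sigma> \<in> causal_sections G"
  then have "\<sigma> face_of \<sigma>" "\<sigma> \<noteq> {}"
    using convex_cone_causal_sections[OF \<sigma>] by (auto intro: face_of_refl simp: convex_cone_def)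
  then show "\<sigma> \<in> universe_fan G"
    using \<sigma> unfolding universe_fan_def by blast
qed

lemma subdivides_universe_fan: "subdivides (universe_fan G) (causal_sections G)"
proof -
  have "\<exists>\<sigma>\<in>causal_sections G. \<tau> \<subseteq> \<sigma>" if "\<tau> \<in> universe_fan G" for \<tau>
    using that face_of_imp_subset unfolding universe_fan_def by blast
  then show ?thesis
    using causal_sections_subset_universe_fan[of G] unfolding subdivides_def by blast
qed

lemma Delta0_preimage_universe_fan:
  assumes "top \<in> G" "D \<in> Delta0_preimage G (universe_fan G)"
  obtains N where "nested G N" "D face_of nested_cone N \<inter> top_dominated" "D \<noteq> {}"
proof -
  obtain \<tau> \<sigma> where \<sigma>: "\<sigma> \<in> causal_sections G" and \<tau>: "\<tau> face_of \<sigma>" "\<tau> \<noteq> {}"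
    and D: "D = {x \<in> space_on G. Delta0 G x \<in> \<tau>}"
    using assms(2) by (auto simp: Delta0_preimage_def universe_fan_def)
  define S where "S = {x \<in> space_on G. Delta0 G x \<in> \<sigma>}"
  have "S \<in> Delta0_preimage G (causal_sections G)"
    using \<sigma> by (auto simp: Delta0_preimage_def S_def)
  then obtain N where N: "nested G N" "S = nested_cone N \<inter> top_dominated"
    unfolding Delta0_preimage_causal_sections[OF assms(1)] by blast
  have c\<sigma>: "convex_cone \<sigma>"
    using convex_cone_causal_sections[OF \<sigma>] .
  have cS: "convex_cone S"
    unfolding S_def
    using convex_cone_linear_preimage[OF c\<sigma> subspace_imp_convex_cone[OF subspace_space_on] linear_Delta0] .
  have "Delta0 G ` S \<subseteq> \<sigma>"
    by (auto simp: S_def)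
  note face_of_linear_preimage[OF c\<sigma> cS linear_Delta0 \<tau> this]
  moreover have "{x \<in> S. Delta0 G x \<in> \<tau>} = D"
    using face_of_imp_subset[OF \<tau>(1)] by (auto simp: S_def D)
  ultimately show ?thesis
    using that N by auto
qed

section \<open>Images in the quotient by the total vector\<close>

lemma linear_p_map: "linear (p_map G)"
  by (intro linearI) (simp_all add: p_map_def scaleR_add_left sum.distrib scaleR_sum_right)

lemma linear_quot_map: "linear quot_map"
  by (intro linearI; transfer) (simp_all add: utot_rel_def span_zero)

lemma linear_pbar_map: "linear (pbar_map G)"
  using linear_compose[OF linear_p_map linear_quot_map, of G] by (simp add: pbar_map_def[abs_def] comp_def)

lemma quot_map_eq_iff: "quot_map v = quot_map w \<longleftrightarrow> (\<exists>c. v = w + c *\<^sub>R u_tot)"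
proof -
  have "quot_map v = quot_map w \<longleftrightarrow> v - w \<in> span {u_tot}"
    by transfer (simp add: utot_rel_def)
  then show ?thesis
    by (auto simp: span_singleton algebra_simps)
qed

lemma quot_map_u_tot: "quot_map u_tot = 0"
proof -
  have "\<exists>c. u_tot = 0 + c *\<^sub>R (u_tot :: 'a rvec)"
    by (rule exI[of _ 1]) simp
  then have "quot_map (u_tot :: 'a rvec) = quot_map 0"
    by (simp only: quot_map_eq_iff)
  then show ?thesis
    by (simp add: linear_0[OF linear_quot_map])
qed

lemma p_map_top: "top \<in> G \<Longrightarrow> p_map G (basis_vec top) = u_tot"
  by (simp add: p_map_def u_tot_def basis_vec_nth if_distrib[of "\<lambda>c. c *\<^sub>R _"] cong: if_cong)

lemma pbar_map_top: "top \<in> G \<Longrightarrow> pbar_map G (basis_vec top) = 0"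
  by (simp add: pbar_map_def p_map_top quot_map_u_tot)

lemma pbar_map_add_top: "top \<in> G \<Longrightarrow> pbar_map G (x + c *\<^sub>R basis_vec top) = pbar_map G x"
  by (simp add: linear_add[OF linear_pbar_map] linear_scale[OF linear_pbar_map] pbar_map_top)

lemma add_top_mem_nested_cone:
  assumes "x \<in> nested_cone N" "top \<in> N" "0 \<le> c"
  shows "x + c *\<^sub>R basis_vec top \<in> nested_cone N"
  using assms by (auto simp: nested_cone_iff basis_vec_nth)

lemma add_top_mem_top_dominated:
  assumes "x \<in> nested_cone N" "(\<Sum>f\<in>UNIV. x $ f) \<le> c"
  shows "x + c *\<^sub>R basis_vec top \<in> top_dominated"
proof -
  have "x $ f \<le> (\<Sum>f\<in>UNIV. x $ f)" "0 \<le> x $ f" for f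
    using assms(1) by (auto simp: nested_cone_iff intro!: member_le_sum)
  then have "x $ f \<le> c" "0 \<le> x $ f" for f
    using assms(2) order_trans by blast+
  then show ?thesis
    by (auto simp: top_dominated_def basis_vec_nth add_increasing)
qed

text \<open>
  A large multiple of the basis vector of \<open>top\<close> moves any vector into the region \<open>top_dominated\<close>, and the
  quotient does not notice it.
\<close>

lemma pbar_map_nested_cone_Int_top_dominated:
  assumes "top \<in> G" "top \<in> N"
  shows "pbar_map G ` (nested_cone N \<inter> top_dominated) = pbar_map G ` nested_cone N"
proof -
  have "pbar_map G x \<in> pbar_map G ` (nested_cone N \<inter> top_dominated)" if x: "x \<in> nested_cone N" for x
  proof -
    define c where "c = (\<Sum>f\<in>UNIV. x $ f)"
    have "0 \<le> c"
      using x by (auto simp: c_def nested_cone_iff intro!: sum_nonneg)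
    then have "x + c *\<^sub>R basis_vec top \<in> nested_cone N \<inter> top_dominated"
      using add_top_mem_nested_cone[OF x assms(2)] add_top_mem_top_dominated[OF x] by (simp add: c_def)
    then show ?thesis
      using pbar_map_add_top[OF assms(1), of x c] by (metis imageI)
  qed
  then show ?thesis
    by blast
qed

text \<open>
  At the basis vector \<open>e\<close> of \<open>top\<close> all the inequalities \<open>x $ f \<le> x $ top\<close> with \<open>f < top\<close> are strict, so a face
  containing \<open>e\<close> is cut out by the vanishing of coordinates alone.  The witness \<open>A\<close> is the set of
  coordinates that are not forced to vanish.
\<close>

lemma pbar_map_face_top_dominated:
  assumes top: "top \<in> G" and N: "nested G N"
    and D: "D face_of nested_cone N \<inter> top_dominated" and e: "basis_vec top \<in> D"
  obtains A where "nested G A" "top \<in> A" "pbar_map G ` D = pbar_map G ` nested_cone A"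
proof -
  let ?e = "basis_vec top :: 'a rvec"
  have cK: "convex_cone (nested_cone N \<inter> top_dominated)"
    using convex_cone_nested_cone[of N] convex_cone_top_dominated by (auto simp: convex_cone_iff)
  note DD = face_of_convex_coneD[OF cK D]
  have ne: "D \<noteq> {}"
    using e by blast
  \<comment> \<open>For \<open>f \<noteq> top\<close>, \<open>basis_vec f\<close> itself violates \<open>x $ f \<le> x $ top\<close>; adding \<open>?e\<close> repairs this.\<close>
  define A where "A = {f \<in> N. basis_vec f + ?e \<in> D}"
  have "top \<in> N"
    using DD(2)[OF ne] e by (auto simp: nested_cone_iff basis_vec_nth split: if_splits)
  then have topA: "top \<in> A"
    using convex_cone_add[OF DD(1)[OF ne] e e] by (simp add: A_def)
  have DA: "x \<in> nested_cone A" if x: "x \<in> D" for x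
  proof -
    have x0: "0 \<le> x $ f" "f \<notin> N \<Longrightarrow> x $ f = 0" "x $ f \<le> x $ top" for f
      using x DD(2)[OF ne] by (auto simp: nested_cone_iff top_dominated_def)
    have "f \<in> A" if f: "x $ f \<noteq> 0" "f \<noteq> top" for f
    proof -
      let ?u = "x $ f *\<^sub>R (basis_vec f + ?e)" and ?w = "x - x $ f *\<^sub>R basis_vec f"
      have fN: "f \<in> N"
        using x0(2) f(1) by blast
      have "?u \<in> nested_cone N \<inter> top_dominated" "?w \<in> nested_cone N \<inter> top_dominated"
        using x0 fN f(2) \<open>top \<in> N\<close>
        by (auto simp: nested_cone_iff top_dominated_def basis_vec_nth)
      moreover have "?u + ?w = x + x $ f *\<^sub>R ?e"
        by (simp add: algebra_simps)
      moreover have "x + x $ f *\<^sub>R ?e \<in> D"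
        using DD(1)[OF ne] x e x0(1) by (intro convex_cone_add convex_cone_scaleR)
      \<comment> \<open>Inside \<open>top_dominated\<close>, the component at \<open>f\<close> splits off only after \<open>x\<close> is shifted in direction \<open>?e\<close>.\<close>
      ultimately have "?u \<in> D"
        using DD(3)[OF ne, of ?u ?w] by metis
      from convex_cone_scaleR[OF DD(1)[OF ne] _ this, of "1 / x $ f"] have "basis_vec f + ?e \<in> D"
        using x0(1)[of f] f by simp
      then show ?thesis
        using fN by (simp add: A_def)
    qed
    then show ?thesis
      using x0 topA by (auto simp: nested_cone_iff)
  qed
  have "pbar_map G x \<in> pbar_map G ` D" if x: "x \<in> nested_cone A" for x
  proof -
    have "x $ f *\<^sub>R (basis_vec f + ?e) \<in> D" for f
    proof (cases "f \<in> A")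
      case True
      then show ?thesis
        using x by (intro convex_cone_scaleR[OF DD(1)[OF ne]]) (auto simp: A_def nested_cone_iff)
    next
      case False
      then show ?thesis
        using x convex_cone_contains_0[OF DD(1)[OF ne]] by (simp add: nested_cone_iff)
    qed
    then have "(\<Sum>f\<in>UNIV. x $ f *\<^sub>R (basis_vec f + ?e)) \<in> D"
      by (intro convex_cone_sum[OF DD(1)[OF ne]])
    moreover have "(\<Sum>f\<in>UNIV. x $ f *\<^sub>R (basis_vec f + ?e)) = x + (\<Sum>f\<in>UNIV. x $ f) *\<^sub>R ?e"
      using vec_eq_sum_basis_vec[of x] by (simp add: scaleR_add_right sum.distrib scaleR_sum_left)
    ultimately show ?thesis
      using pbar_map_add_top[OF top] by (metis imageI)
  qed
  then have "pbar_map G ` D = pbar_map G ` nested_cone A"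
    using DA by blast
  moreover have "nested G A"
    by (rule nested_subset[OF N]) (auto simp: A_def)
  ultimately show ?thesis
    using that topA by blast
qed

text \<open>
  Equality in the quotient means that the images under \<open>p\<close> differ by a multiple of \<open>u_tot\<close>.  After
  swapping \<open>x\<close> and \<open>y\<close> if necessary the multiple is nonnegative, hence comes from a vector of
  the cone of \<open>insert top N'\<close>, and injectivity of \<open>p\<close> applies.
\<close>

lemma pbar_map_inj_mod_top:
  fixes G :: "'a::{finite,complete_lattice} set"
  assumes atomic: "\<And>f::'a. f = Sup {e \<in> atoms. e \<le> f}" and G: "building_set G"
    and x: "nested G N" "x \<in> nested_cone N" and y: "nested G N'" "y \<in> nested_cone N'"
    and eq: "pbar_map G x = pbar_map G y"
  shows "\<exists>c\<ge>0. x = y + c *\<^sub>R basis_vec top \<or> y = x + c *\<^sub>R basis_vec top"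
proof -
  have top: "top \<in> G"
    using building_setD(2)[OF G] .
  have *: "v = w + c *\<^sub>R basis_vec top"
    if "nested G M" "v \<in> nested_cone M" "nested G M'" "w \<in> nested_cone M'" "0 \<le> c"
      "p_map G v = p_map G w + c *\<^sub>R u_tot" for v w M M' c
  proof (rule p_map_inj_nested[OF atomic G that(1,2) nested_insert_top[OF top that(3)]])
    have "w \<in> nested_cone (insert top M')"
      using that(4) by (simp add: nested_cone_iff)
    then show "w + c *\<^sub>R basis_vec top \<in> nested_cone (insert top M')"
      using that(5) by (intro add_top_mem_nested_cone) auto
    show "p_map G v = p_map G (w + c *\<^sub>R basis_vec top)"
      using that(6) by (simp add: linear_add[OF linear_p_map] linear_scale[OF linear_p_map] p_map_top[OF top])
  qed
  obtain c where c: "p_map G x = p_map G y + c *\<^sub>R u_tot"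
    using eq by (auto simp: pbar_map_def quot_map_eq_iff)
  show ?thesis
  proof (cases "0 \<le> c")
    case True
    then show ?thesis
      using *[OF x y True c] by blast
  next
    case False
    then have "y = x + (- c) *\<^sub>R basis_vec top"
      using c by (intro *[OF y x]) auto
    then show ?thesis
      using False by (intro exI[of _ "- c"]) auto
  qed
qed

text \<open>
  Since \<open>p\<close> is injective on the nested cones, the cones whose image contains \<open>u_tot\<close> are those that
  contain the basis vector of \<open>top\<close>.
\<close>

lemma pbar_fan_eq:
  fixes G :: "'a::{finite,complete_lattice} set"
  assumes atomic: "\<And>f::'a. f = Sup {e \<in> atoms. e \<le> f}" and G: "building_set G"
    and \<Delta>: "\<And>D. D \<in> \<Delta> \<Longrightarrow> \<exists>N. nested G N \<and> D \<subseteq> nested_cone N"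
  shows "pbar_fan G \<Delta> = {pbar_map G ` D | D. D \<in> \<Delta> \<and> basis_vec top \<in> D}"
proof -
  have top: "top \<in> G"
    using building_setD(2)[OF G] .
  have star: "u_tot \<in> p_map G ` D \<longleftrightarrow> basis_vec top \<in> D" if D: "D \<in> \<Delta>" for D
  proof
    assume "u_tot \<in> p_map G ` D"
    then obtain x where x: "x \<in> D" "p_map G x = p_map G (basis_vec top)"
      using p_map_top[OF top] by auto
    obtain N where N: "nested G N" "x \<in> nested_cone N"
      using \<Delta>[OF D] x(1) by blast
    have "nested G {top}"
      using nested_insert_top[OF top, of "{}"] by (simp add: nested_def)
    moreover have "basis_vec top \<in> nested_cone {top :: 'a}"
      by (simp add: nested_cone_iff basis_vec_nth)
    ultimately show "basis_vec top \<in> D"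
      using p_map_inj_nested[OF atomic G N _ _ x(2)] x(1) by metis
  next
    assume "basis_vec top \<in> D"
    then show "u_tot \<in> p_map G ` D"
      using p_map_top[OF top] by (metis imageI)
  qed
  have "pbar_fan G \<Delta> = {quot_map ` p_map G ` D | D. D \<in> \<Delta> \<and> u_tot \<in> p_map G ` D}"
    by (auto simp: pbar_fan_def quot_fan_def image_cones_def)
  also have "\<dots> = {quot_map ` p_map G ` D | D. D \<in> \<Delta> \<and> basis_vec top \<in> D}"
    by (simp only: star cong: conj_cong)
  also have "\<dots> = {pbar_map G ` D | D. D \<in> \<Delta> \<and> basis_vec top \<in> D}"
    by (simp only: image_image pbar_map_def[abs_def])
  finally show ?thesis .
qed

lemma nested_fan_eq: "nested_fan G = image_cones (p_map G) {nested_cone N | N. nested G N}"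
  by (auto simp: nested_fan_def image_cones_def)

lemma reduced_nested_fan_eq:
  fixes G :: "'a::{finite,complete_lattice} set"
  assumes atomic: "\<And>f::'a. f = Sup {e \<in> atoms. e \<le> f}" and G: "building_set G"
  shows "reduced_nested_fan G = {pbar_map G ` nested_cone N | N. nested G N \<and> top \<in> N}"
proof -
  have "reduced_nested_fan G = pbar_fan G {nested_cone N | N. nested G N}"
    by (simp add: reduced_nested_fan_def nested_fan_eq pbar_fan_def)
  also have "\<dots> = {pbar_map G ` D | D. D \<in> {nested_cone N | N. nested G N} \<and> basis_vec top \<in> D}"
    by (rule pbar_fan_eq[OF atomic G]) auto
  also have "\<dots> = {pbar_map G ` nested_cone N | N. nested G N \<and> top \<in> N}"
  proof -
    have "basis_vec top \<in> nested_cone N \<longleftrightarrow> top \<in> N" for N :: "'a set"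
      by (auto simp: nested_cone_iff basis_vec_nth)
    then show ?thesis
      by blast
  qed
  finally show ?thesis .
qed

text \<open>
  If \<open>top \<notin> N\<close>, domination by the vanishing coordinate at \<open>top\<close> reduces the section to \<open>0\<close>, whose image
  is also the image of the ray of \<open>top\<close>.
\<close>

lemma pbar_map_causal_section:
  fixes G :: "'a::{finite,complete_lattice} set"
  assumes atomic: "\<And>f::'a. f = Sup {e \<in> atoms. e \<le> f}" and G: "building_set G"
    and N: "nested G N"
  shows "pbar_map G ` (nested_cone N \<inter> top_dominated) \<in> reduced_nested_fan G"
proof (cases "top \<in> N")
  case True
  then show ?thesis
    using N pbar_map_nested_cone_Int_top_dominated[OF building_setD(2)[OF G] True]
    unfolding reduced_nested_fan_eq[OF atomic G] by blast
next
  case False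
  have top: "top \<in> G"
    using building_setD(2)[OF G] .
  have "x $ f = 0" if "x \<in> nested_cone N \<inter> top_dominated" for x f
    using that False unfolding nested_cone_iff top_dominated_def Int_iff mem_Collect_eq
    by (metis antisym)
  then have "nested_cone N \<inter> top_dominated \<subseteq> {0}"
    by (auto simp: vec_eq_iff)
  moreover have "0 \<in> nested_cone N \<inter> top_dominated"
    using convex_cone_contains_0 convex_cone_nested_cone convex_cone_top_dominated by blast
  ultimately have "nested_cone N \<inter> top_dominated = {0}"
    by blast
  then have 1: "pbar_map G ` (nested_cone N \<inter> top_dominated) = {0}"
    by (simp add: linear_0[OF linear_pbar_map])
  have "x = 0 + (x $ top) *\<^sub>R basis_vec top" if "x \<in> nested_cone {top}" for x :: "'a rvec"
    using that by (auto simp: vec_eq_iff nested_cone_iff basis_vec_nth)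
  then have "pbar_map G x = 0" if "x \<in> nested_cone {top}" for x
    using that pbar_map_add_top[OF top, of 0] linear_0[OF linear_pbar_map, of G] by metis
  then have "pbar_map G ` nested_cone {top} = {0}"
    using convex_cone_nonempty[OF convex_cone_nested_cone[of "{top}"]] by auto
  moreover have "nested G {top}"
    using nested_insert_top[OF top, of "{}"] by (simp add: nested_def)
  ultimately show ?thesis
    using 1 unfolding reduced_nested_fan_eq[OF atomic G] by (intro CollectI exI[of _ "{top}"]) simp
qed

section \<open>Refinements\<close>

lemma subdivides_trans: "subdivides \<Gamma> \<Sigma> \<Longrightarrow> subdivides \<Sigma> \<Theta> \<Longrightarrow> subdivides \<Gamma> \<Theta>"
  unfolding subdivides_def by (metis order_trans)

lemma subdivides_Delta0_preimage:
  assumes "subdivides \<Gamma> \<Sigma>"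
  shows "subdivides (Delta0_preimage G \<Gamma>) (Delta0_preimage G \<Sigma>)"
proof -
  have U: "\<Union>(Delta0_preimage G \<Theta>) = {x \<in> space_on G. Delta0 G x \<in> \<Union>\<Theta>}" for \<Theta>
    by (auto simp: Delta0_preimage_def)
  have "\<exists>S\<in>Delta0_preimage G \<Sigma>. D \<subseteq> S" if *: "D \<in> Delta0_preimage G \<Gamma>" for D
  proof -
    obtain \<gamma> where "\<gamma> \<in> \<Gamma>" and D: "D = {x \<in> space_on G. Delta0 G x \<in> \<gamma>}"
      using * by (auto simp: Delta0_preimage_def)
    then obtain \<sigma> where "\<sigma> \<in> \<Sigma>" "\<gamma> \<subseteq> \<sigma>"
      using assms by (auto simp: subdivides_def)
    then show ?thesis
      unfolding D by (intro bexI[of _ "{x \<in> space_on G. Delta0 G x \<in> \<sigma>}"])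
        (auto simp: Delta0_preimage_def)
  qed
  moreover have "\<Union>\<Gamma> = \<Union>\<Sigma>"
    using assms by (simp add: subdivides_def)
  ultimately show ?thesis
    unfolding subdivides_def U by simp
qed

lemma subdivides_image_cones:
  assumes "subdivides \<Gamma> \<Sigma>"
  shows "subdivides (image_cones f \<Gamma>) (image_cones f \<Sigma>)"
proof -
  have U: "\<Union>(image_cones f \<Theta>) = f ` \<Union>\<Theta>" for \<Theta>
    by (auto simp: image_cones_def)
  have "\<exists>S\<in>image_cones f \<Sigma>. D \<subseteq> S" if *: "D \<in> image_cones f \<Gamma>" for D
  proof -
    obtain \<gamma> where "\<gamma> \<in> \<Gamma>" and D: "D = f ` \<gamma>"
      using * by (auto simp: image_cones_def)
    then obtain \<sigma> where "\<sigma> \<in> \<Sigma>" "\<gamma> \<subseteq> \<sigma>"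
      using assms by (auto simp: subdivides_def)
    then show ?thesis
      unfolding D by (intro bexI[of _ "f ` \<sigma>"]) (auto simp: image_cones_def)
  qed
  moreover have "\<Union>\<Gamma> = \<Union>\<Sigma>"
    using assms by (simp add: subdivides_def)
  ultimately show ?thesis
    unfolding subdivides_def U by simp
qed

lemma fan_Delta0_preimage: "fan \<Gamma> \<Longrightarrow> fan (Delta0_preimage G \<Gamma>)"
  unfolding Delta0_preimage_def by (rule fan_linear_preimage[OF _ subspace_space_on linear_Delta0])

text \<open>
  A fan that covers a half-line in direction \<open>e\<close> has a cone in the star of \<open>e\<close> that meets the half-line:
  by finiteness one cone contains points of the half-line arbitrarily far out, and the
  directions of these points converge to \<open>e\<close>.
\<close>

lemma fan_star_absorbs:
  fixes \<Gamma> :: "'b::euclidean_space set set"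
  assumes \<Gamma>: "fan \<Gamma>" and ray: "\<And>n. n0 \<le> n \<Longrightarrow> x + real n *\<^sub>R e \<in> \<Union>\<Gamma>"
  obtains \<sigma> n where "\<sigma> \<in> \<Gamma>" "e \<in> \<sigma>" "x + real n *\<^sub>R e \<in> \<sigma>"
proof -
  define s where "s n = (SOME \<sigma>. \<sigma> \<in> \<Gamma> \<and> x + real n *\<^sub>R e \<in> \<sigma>)" for n
  have "s n \<in> \<Gamma> \<and> x + real n *\<^sub>R e \<in> s n" if "n0 \<le> n" for n
    unfolding s_def using ray[OF that]
    by (intro someI_ex[where P = "\<lambda>\<sigma>. \<sigma> \<in> \<Gamma> \<and> x + real n *\<^sub>R e \<in> \<sigma>"]) blast
  then have s: "\<And>n. n0 \<le> n \<Longrightarrow> s n \<in> \<Gamma>" "\<And>n. n0 \<le> n \<Longrightarrow> x + real n *\<^sub>R e \<in> s n"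
    by blast+
  have "finite \<Gamma>" "s ` {n0..} \<subseteq> \<Gamma>"
    using \<Gamma> s(1) by (auto simp: fan_def)
  then have "finite (s ` {n0..})"
    by (rule finite_subset[rotated])
  then obtain m where m: "m \<in> {n0..}" "infinite {n \<in> {n0..}. s n = s m}"
    using pigeonhole_infinite[of "{n0..}" s] infinite_Ici by blast
  have \<sigma>: "s m \<in> \<Gamma>"
    using m(1) s(1) by simp
  have "\<exists>y\<in>s m. dist y e < \<epsilon>" if \<epsilon>: "0 < \<epsilon>" for \<epsilon>
  proof -
    obtain k :: nat where k: "norm x / \<epsilon> < real k"
      using reals_Archimedean2 by blast
    obtain n where n: "k < n" "n0 \<le> n" "s n = s m"
      using m(2) by (auto simp: infinite_nat_iff_unbounded)
    have n0: "0 < real n"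
      using n(1) by simp
    have "(1 / real n) *\<^sub>R (x + real n *\<^sub>R e) \<in> s m"
      using s(2)[OF n(2)] n(3) by (intro convex_cone_scaleR[OF fan_convex_cone[OF \<Gamma> \<sigma>]]) auto
    moreover have "(1 / real n) *\<^sub>R (x + real n *\<^sub>R e) = e + (1 / real n) *\<^sub>R x"
      using n0 by (simp add: scaleR_add_right)
    moreover have "norm x < \<epsilon> * real k"
      using k \<epsilon> by (simp add: field_simps)
    then have "norm x < \<epsilon> * real n"
      using n(1) \<epsilon> by (elim less_trans) simp
    then have "dist (e + (1 / real n) *\<^sub>R x) e < \<epsilon>"
      using n0 by (simp add: dist_norm field_simps)
    ultimately show ?thesis
      by metis
  qed
  then have "e \<in> s m"
    using fan_closed[OF \<Gamma> \<sigma>] by (metis closure_approachable closure_closed)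
  then show ?thesis
    using that \<sigma> s(2) m(1) by auto
qed

text \<open>
  The instance \<open>e = 0\<close> of the star of a fan, where the map is injective on the whole support.
\<close>

lemma fan_refines_nested_fan:
  fixes G :: "'a::{finite,complete_lattice} set"
  assumes atomic: "\<And>f::'a. f = Sup {e \<in> atoms. e \<le> f}" and G: "building_set G"
    and \<Delta>: "fan \<Delta>" "subdivides \<Delta> {nested_cone N | N. nested G N}"
  shows "fan_refines (image_cones (p_map G) \<Delta>) (nested_fan G)"
proof -
  have supp: "\<exists>N. nested G N \<and> x \<in> nested_cone N" if "x \<in> \<Union>\<Delta>" for x
    using that \<Delta>(2) unfolding subdivides_def by blast
  have "fan {p_map G ` \<sigma> | \<sigma>. \<sigma> \<in> \<Delta> \<and> 0 \<in> \<sigma>}"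
  proof (rule fan_image_star[OF \<Delta>(1) linear_p_map linear_0[OF linear_p_map]])
    fix x y assume "x \<in> \<Union>\<Delta>" "y \<in> \<Union>\<Delta>" "p_map G x = p_map G y"
    then have "x = y"
      using supp p_map_inj_nested[OF atomic G] by metis
    then show "\<exists>c\<ge>0. x = y + c *\<^sub>R 0 \<or> y = x + c *\<^sub>R 0"
      by auto
  qed
  moreover have "0 \<in> \<sigma>" if "\<sigma> \<in> \<Delta>" for \<sigma>
    using convex_cone_contains_0[OF fan_convex_cone[OF \<Delta>(1) that]] .
  then have "{p_map G ` \<sigma> | \<sigma>. \<sigma> \<in> \<Delta> \<and> 0 \<in> \<sigma>} = image_cones (p_map G) \<Delta>"
    unfolding image_cones_def by blast
  ultimately show ?thesis
    using subdivides_image_cones[OF \<Delta>(2)] by (simp add: fan_refines_def nested_fan_eq)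
qed

text \<open>
  Only the cones in the star of the basis vector of \<open>top\<close> contribute to the left-hand side.  They suffice
  to cover the link, since every point of a nested cone that contains this vector can be pushed in its
  direction, without changing the image, until it lies in a cone of the star.
\<close>

lemma fan_refines_reduced_nested_fan:
  fixes G :: "'a::{finite,complete_lattice} set"
  assumes atomic: "\<And>f::'a. f = Sup {e \<in> atoms. e \<le> f}" and G: "building_set G"
    and \<Delta>: "fan \<Delta>" "subdivides \<Delta> {nested_cone N \<inter> top_dominated | N. nested G N}"
  shows "fan_refines (pbar_fan G \<Delta>) (reduced_nested_fan G)"
proof -
  let ?e = "basis_vec top :: 'a rvec"
  have top: "top \<in> G"
    using building_setD(2)[OF G] .
  have sub: "\<exists>N. nested G N \<and> D \<subseteq> nested_cone N \<inter> top_dominated" if "D \<in> \<Delta>" for D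
    using that \<Delta>(2) unfolding subdivides_def by blast
  have supp: "\<exists>N. nested G N \<and> x \<in> nested_cone N" if "x \<in> \<Union>\<Delta>" for x
    using that sub by blast
  have eq: "pbar_fan G \<Delta> = {pbar_map G ` D | D. D \<in> \<Delta> \<and> ?e \<in> D}"
    using sub by (intro pbar_fan_eq[OF atomic G]) blast
  have fan: "fan (pbar_fan G \<Delta>)"
    unfolding eq
  proof (rule fan_image_star[OF \<Delta>(1) linear_pbar_map pbar_map_top[OF top]])
    fix x y assume *: "x \<in> \<Union>\<Delta>" "y \<in> \<Union>\<Delta>" "pbar_map G x = pbar_map G y"
    obtain N N' where "nested G N" "x \<in> nested_cone N" "nested G N'" "y \<in> nested_cone N'"
      using supp[OF *(1)] supp[OF *(2)] by blast
    then show "\<exists>c\<ge>0. x = y + c *\<^sub>R ?e \<or> y = x + c *\<^sub>R ?e"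
      using *(3) by (rule pbar_map_inj_mod_top[OF atomic G])
  qed
  have below: "\<exists>S\<in>reduced_nested_fan G. C \<subseteq> S" if C: "C \<in> pbar_fan G \<Delta>" for C
  proof -
    obtain D where D: "D \<in> \<Delta>" "C = pbar_map G ` D"
      using C unfolding eq by blast
    then obtain N where "nested G N" "D \<subseteq> nested_cone N \<inter> top_dominated"
      using sub by blast
    then show ?thesis
      unfolding D(2) by (intro bexI[OF _ pbar_map_causal_section[OF atomic G]] image_mono)
  qed
  have "v \<in> \<Union>(pbar_fan G \<Delta>)" if v: "v \<in> \<Union>(reduced_nested_fan G)" for v
  proof -
    obtain N x where N: "nested G N" "top \<in> N" and x: "x \<in> nested_cone N" "v = pbar_map G x"
      using v unfolding reduced_nested_fan_eq[OF atomic G] by blast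
    obtain n0 :: nat where n0: "(\<Sum>f\<in>UNIV. x $ f) \<le> real n0"
      using real_arch_simple by blast
    have "x + real n *\<^sub>R ?e \<in> \<Union>\<Delta>" if "n0 \<le> n" for n
    proof -
      have "x + real n *\<^sub>R ?e \<in> nested_cone N \<inter> top_dominated"
        using add_top_mem_nested_cone[OF x(1) N(2)] add_top_mem_top_dominated[OF x(1), of "real n"]
          n0 that by auto
      then show ?thesis
        using \<Delta>(2) N(1) unfolding subdivides_def by blast
    qed
    then obtain D n where D: "D \<in> \<Delta>" "?e \<in> D" "x + real n *\<^sub>R ?e \<in> D"
      by (rule fan_star_absorbs[OF \<Delta>(1)])
    have "pbar_map G ` D \<in> pbar_fan G \<Delta>"
      unfolding eq using D(1,2) by (intro CollectI exI[of _ D]) simp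
    moreover have "pbar_map G (x + real n *\<^sub>R ?e) \<in> pbar_map G ` D"
      using D(3) by (rule imageI)
    then have "v \<in> pbar_map G ` D"
      by (simp only: x(2) pbar_map_add_top[OF top])
    ultimately show ?thesis
      by (rule UnionI)
  qed
  then have "\<Union>(reduced_nested_fan G) \<subseteq> \<Union>(pbar_fan G \<Delta>)"
    by (rule subsetI)
  moreover have "\<Union>(pbar_fan G \<Delta>) \<subseteq> \<Union>(reduced_nested_fan G)"
  proof (rule Union_least)
    fix C assume "C \<in> pbar_fan G \<Delta>"
    from below[OF this] show "C \<subseteq> \<Union>(reduced_nested_fan G)"
      by (elim bexE) (rule order_trans[OF _ Union_upper])
  qed
  ultimately show ?thesis
    using fan below unfolding fan_refines_def subdivides_def by (intro conjI ballI equalityI)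
qed

theorem lemma6p1:
  fixes G :: "'a::{finite,complete_lattice} set"
  assumes atomic: "\<And>f::'a. f = Sup {e \<in> atoms. e \<le> f}"
    and building: "building_set G"
  shows "image_cones (p_map G) (Delta0_preimage G (doubled_fan G)) = nested_fan G \<and>
     image_cones (pbar_map G) (Delta0_preimage G (causal_sections G)) = reduced_nested_fan G \<and>
     pbar_fan G (Delta0_preimage G (universe_fan G)) = reduced_nested_fan G \<and>
     (\<forall>\<Gamma>. fan_refines \<Gamma> (doubled_fan G) \<longrightarrow>
        fan_refines (image_cones (p_map G) (Delta0_preimage G \<Gamma>)) (nested_fan G)) \<and>
     (\<forall>\<Gamma>. fan_refines \<Gamma> (universe_fan G) \<longrightarrow>
        subdivides (image_cones (pbar_map G) (Delta0_preimage G \<Gamma>)) (reduced_nested_fan G) \<and>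
        fan_refines (pbar_fan G (Delta0_preimage G \<Gamma>)) (reduced_nested_fan G))"
proof (intro conjI allI impI)
  have top: "top \<in> G"
    using building_setD(2)[OF building] .
  note sections = Delta0_preimage_causal_sections[OF top]
  note reduced = reduced_nested_fan_eq[OF atomic building]
  show "image_cones (p_map G) (Delta0_preimage G (doubled_fan G)) = nested_fan G"
    by (simp add: Delta0_preimage_doubled_fan nested_fan_eq)
  have star: "pbar_map G ` (nested_cone N \<inter> top_dominated) = pbar_map G ` nested_cone N"
    "basis_vec top \<in> nested_cone N \<inter> top_dominated" if "top \<in> N" for N
    using pbar_map_nested_cone_Int_top_dominated[OF top that] that
    by (auto simp: nested_cone_iff top_dominated_def basis_vec_nth)
  show causal: "image_cones (pbar_map G) (Delta0_preimage G (causal_sections G)) = reduced_nested_fan G"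
  proof (intro equalityI subsetI)
    fix C assume "C \<in> image_cones (pbar_map G) (Delta0_preimage G (causal_sections G))"
    then show "C \<in> reduced_nested_fan G"
      using pbar_map_causal_section[OF atomic building] unfolding image_cones_def sections by blast
  next
    fix C assume "C \<in> reduced_nested_fan G"
    then obtain N where N: "nested G N" "top \<in> N" "C = pbar_map G ` nested_cone N"
      unfolding reduced by blast
    have "nested_cone N \<inter> top_dominated \<in> Delta0_preimage G (causal_sections G)"
      unfolding sections using N(1) by blast
    then have "pbar_map G ` (nested_cone N \<inter> top_dominated)
        \<in> image_cones (pbar_map G) (Delta0_preimage G (causal_sections G))"
      unfolding image_cones_def by blast
    then show "C \<in> image_cones (pbar_map G) (Delta0_preimage G (causal_sections G))"
      by (simp only: N(3) star(1)[OF N(2)])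
  qed
  let ?U = "Delta0_preimage G (universe_fan G)"
  have U: "\<exists>N. nested G N \<and> D face_of nested_cone N \<inter> top_dominated" if "D \<in> ?U" for D
    using Delta0_preimage_universe_fan[OF top that] by blast
  have "pbar_fan G ?U = {pbar_map G ` D | D. D \<in> ?U \<and> basis_vec top \<in> D}"
    using U face_of_imp_subset by (intro pbar_fan_eq[OF atomic building]) blast
  also have "\<dots> = reduced_nested_fan G"
  proof (intro equalityI subsetI)
    fix C assume "C \<in> {pbar_map G ` D | D. D \<in> ?U \<and> basis_vec top \<in> D}"
    then obtain D where D: "D \<in> ?U" "basis_vec top \<in> D" "C = pbar_map G ` D"
      by blast
    obtain N where "nested G N" "D face_of nested_cone N \<inter> top_dominated"
      using U[OF D(1)] by blast
    then obtain A where A: "nested G A" "top \<in> A" "pbar_map G ` D = pbar_map G ` nested_cone A"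
      using D(2) by (rule pbar_map_face_top_dominated[OF top])
    then show "C \<in> reduced_nested_fan G"
      unfolding reduced D(3) A(3) by (intro CollectI exI[of _ A]) simp
  next
    fix C assume "C \<in> reduced_nested_fan G"
    then obtain N where N: "nested G N" "top \<in> N" "C = pbar_map G ` nested_cone N"
      unfolding reduced by blast
    have "nested_cone N \<inter> top_dominated \<in> ?U"
    proof -
      have "Delta0_preimage G (causal_sections G) \<subseteq> ?U"
        using causal_sections_subset_universe_fan[of G] by (auto simp: Delta0_preimage_def)
      moreover have "nested_cone N \<inter> top_dominated \<in> Delta0_preimage G (causal_sections G)"
        unfolding sections using N(1) by blast
      ultimately show ?thesis
        by (rule subsetD)
    qed
    then have "pbar_map G ` (nested_cone N \<inter> top_dominated)
        \<in> {pbar_map G ` D | D. D \<in> ?U \<and> basis_vec top \<in> D}"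
      using star(2)[OF N(2)] by blast
    then show "C \<in> {pbar_map G ` D | D. D \<in> ?U \<and> basis_vec top \<in> D}"
      by (simp only: N(3) star(1)[OF N(2)])
  qed
  finally show "pbar_fan G ?U = reduced_nested_fan G" .
  {
    fix \<Gamma> assume "fan_refines \<Gamma> (doubled_fan G)"
    then have "fan (Delta0_preimage G \<Gamma>)"
      "subdivides (Delta0_preimage G \<Gamma>) {nested_cone N | N. nested G N}"
      using fan_Delta0_preimage subdivides_Delta0_preimage[of \<Gamma> "doubled_fan G" G]
      by (auto simp: fan_refines_def Delta0_preimage_doubled_fan)
    then show "fan_refines (image_cones (p_map G) (Delta0_preimage G \<Gamma>)) (nested_fan G)"
      by (rule fan_refines_nested_fan[OF atomic building])
  }
  fix \<Gamma> assume \<Gamma>: "fan_refines \<Gamma> (universe_fan G)"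
  then have sub: "subdivides (Delta0_preimage G \<Gamma>) (Delta0_preimage G (causal_sections G))"
    by (intro subdivides_Delta0_preimage subdivides_trans[OF _ subdivides_universe_fan])
      (simp add: fan_refines_def)
  from subdivides_image_cones[OF this, of "pbar_map G"]
  show "subdivides (image_cones (pbar_map G) (Delta0_preimage G \<Gamma>)) (reduced_nested_fan G)"
    unfolding causal .
  have "fan (Delta0_preimage G \<Gamma>)"
    using \<Gamma> fan_Delta0_preimage by (auto simp: fan_refines_def)
  then show "fan_refines (pbar_fan G (Delta0_preimage G \<Gamma>)) (reduced_nested_fan G)"
    using sub unfolding sections by (rule fan_refines_reduced_nested_fan[OF atomic building])
qed

end
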